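(* Let $c_L\in\mathbb{C}$, $c_{L,I}\in\mathbb{C}\setminus\{0\}$, $r,s\in\mathbb{C}$, and put $h=\Delta_{r,s}=\frac12r^2-\frac12s^2-\lambda r+\mu s$, $h_I=r-s$. Assume that $\frac{h_I}{c_{L,I}}-1\notin-\mathbb{Z}_{>0}$. Then $\mathcal F_{r,s}\cong V^{\mathcal H}(c_L,0,c_{L,I},h,h_I)$ as $L^{\mathcal H}(c_L,c_{L,I})$-modules.
   Context: The twisted Heisenberg-Virasoro algebra $\mathcal H$ is the complex Lie algebra with basis $\{L(n),I(n):n\in\mathbb{Z}\}\cup\{C_L,C_{LI},C_I\}$ and brackets $[L(n),L(m)]=(n-m)L(n+m)+\delta_{n,-m}\frac{n^3-n}{12}C_L$, $[L(n),I(m)]=-mI(n+m)-\delta_{n,-m}(n^2+n)C_{LI}$, $[I(n),I(m)]=n\delta_{n,-m}C_I$, with $C_L,C_{LI},C_I$ central. $V^{\mathcal H}(c_L,0,c_{L,I},h,h_I)$ is the Verma module with highest weight vector $v_{h,h_I}$: $L(n),I(n)$ with $n>0$ annihilate $v_{h,h_I}$, $L(0),I(0)$ act on it by $h,h_I$, and $C_L,C_I,C_{LI}$ act as $c_L,0,c_{L,I}$; it is free of rank one over $U(\mathcal H_-)$, $\mathcal H_-=\mathrm{span}\{L(-n),I(-n):n\ge1\}$. $L^{\mathcal H}(c_L,0,c_{L,I},h,h_I)$ is its irreducible quotient. $L^{\mathcal H}(c_L,c_{L,I})$ denotes $L^{\mathcal H}(c_L,0,c_{L,I},0,0)$ with its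 structure of simple vertex algebra generated by $I(z)=\sum I(n)z^{-n-1}$ and $L(z)=\sum L(n)z^{-n-2}$. Free field realization. Put $\lambda=\frac{2-c_L}{24c_{L,I}}+\frac12c_{L,I}$, $\mu=\frac{2-c_L}{24c_{L,I}}-\frac12c_{L,I}$ (equivalently $c_L=2-12(\lambda^2-\mu^2)$, $c_{L,I}=\lambda-\mu$). Let $\mathfrak h=\mathbb{C}\alpha\oplus\mathbb{C}\beta$ with $\langle\alpha,\alpha\rangle=-\langle\beta,\beta\rangle=1$, $\langle\alpha,\beta\rangle=0$, and $\widehat{\mathfrak h}=\mathbb{C}[t,t^{-1}]\otimes\mathfrak h\oplus\mathbb{C}c$ its affinization, $\delta(n)=t^n\otimes\delta$. For $\gamma\in\mathfrak h$, $M(1,\gamma)$ is the $\widehat{\mathfrak h}$-module induced from the one-dimensional module spanned by $e^\gamma$ on which $\delta(n)$ acts as $0$ for $n>0$, $\delta(0)$ acts as $\langle\delta,\gamma\rangle$, and $c$ acts as $1$. $M(1)=M(1,0)$ is the Heisenberg vertex algebra, each $M(1,\gamma)$ is an $M(1)$-module, and $\mathcal F_{r,s}:=M(1,r\alpha+s\beta)$. The vectors $I=\alpha(-1)+\beta(-1)$ and $\omega=\frac12\alpha(-1)^2-\frac12\beta(-1)^2+\lambda\alpha(-2)+\mu\beta(-2)$ generate a vertex subalgebra of $M(1)$ isomorphic to $L^{\mathcal H}(c_L,c_{L,I})$, via $Y(I,z)=\sum_nI(n)z^{-n-1}$, $Y(\omega,z)=\sum_nL(n)z^{-n-2}$; so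 each $\mathcal F_{r,s}$ is an $L^{\mathcal H}(c_L,c_{L,I})$-module and an $\mathcal H$-module. *)

theory Defs
  imports
    Complex_Main
    "HOL-Library.Poly_Mapping"
    "HOL-Library.Set_Algebras"
    "HOL-Algebra.Module"
    "HOL-Algebra.Algebraic_Closure_Type"
begin

section \<open>Free associative algebras and induced modules\<close>

text \<open>
  With concatenation as addition on words, the library's convolution product turns
  \<open>'g list \<Rightarrow>\<^sub>0 complex\<close> into the free associative algebra on \<open>'g\<close>, i.e. the tensor algebra
  of the complex vector space with basis \<open>'g\<close>.
\<close>

instantiation list :: (type) monoid_add
begin
definition zero_list :: "'a list" where "zero_list = []"
definition plus_list :: "'a list \<Rightarrow> 'a list \<Rightarrow> 'a list" where "plus_list xs ys = xs @ ys"
instance by standard (simp_all add: zero_list_def plus_list_def)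
end

type_synonym 'g tensor = "'g list \<Rightarrow>\<^sub>0 complex"

definition gen :: "'g \<Rightarrow> 'g tensor" where
  "gen x = Poly_Mapping.single [x] 1"

definition scal :: "complex \<Rightarrow> 'g tensor" where
  "scal c = Poly_Mapping.single [] c"

definition left_ideal :: "'g tensor set \<Rightarrow> bool" where
  "left_ideal K \<longleftrightarrow> 0 \<in> K \<and> (\<forall>x\<in>K. \<forall>y\<in>K. x + y \<in> K) \<and> (\<forall>t. \<forall>x\<in>K. t * x \<in> K)"

definition left_ideal_generated :: "'g tensor set \<Rightarrow> 'g tensor set" where
  "left_ideal_generated S = \<Inter>{K. left_ideal K \<and> S \<subseteq> K}"

text \<open>
  Let \<open>\<gg>\<close> be the Lie algebra with basis \<open>'g\<close> and bracket \<open>br\<close> (values are linear combinations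
  of generators), let \<open>P\<close> be a set of basis elements spanning a subalgebra \<open>\<pp>\<close>, and let
  \<open>\<chi>\<close> be a character of \<open>\<pp>\<close>. If \<open>T\<close> is the tensor algebra, then \<open>U(\<gg>)\<close> is \<open>T\<close> modulo the
  two-sided ideal generated by all \<open>xy - yx - [x,y]\<close>, and the induced module of the
  one-dimensional module \<open>\<complex>\<^sub>\<chi>\<close> is \<open>U(\<gg>)\<close> modulo the left ideal generated by all
  \<open>x - \<chi>(x)\<close>, \<open>x \<in> P\<close>. Both steps together divide \<open>T\<close> by the following left ideal.
\<close>

definition induced_ideal ::
    "('g \<Rightarrow> 'g \<Rightarrow> 'g tensor) \<Rightarrow> 'g set \<Rightarrow> ('g \<Rightarrow> complex) \<Rightarrow> 'g tensor set" where
  "induced_ideal br P \<chi> = left_ideal_generated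
     ({(gen x * gen y - gen y * gen x - br x y) * t | x y t. True} \<union> {gen x - scal (\<chi> x) | x. x \<in> P})"

abbreviation complex_ring :: "complex ring" where
  "complex_ring \<equiv> ring_of_type_algebra"

text \<open>
  The vector space \<open>T/J\<close> of cosets of a left ideal \<open>J\<close>; the operations are those of
  \<^theory>\<open>HOL-Library.Set_Algebras\<close>. Adding \<open>J\<close> in \<open>smult\<close> and \<open>coset_act\<close> completes the set of
  all \<open>t * x\<close>, for \<open>x\<close> in the given coset, to a coset. The ring fields
  \<open>mult\<close> and \<open>one\<close> of the record play no role in a module.
\<close>

definition coset_act :: "'g tensor set \<Rightarrow> 'g tensor \<Rightarrow> 'g tensor set \<Rightarrow> 'g tensor set" where
  "coset_act J t A = (t *o A) + J"

definition quotient_space :: "'g tensor set \<Rightarrow> (complex, 'g tensor set) module" where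
  "quotient_space J =
     \<lparr>carrier = range (\<lambda>x. x +o J), monoid.mult = undefined, one = undefined,
      zero = J, add = (\<lambda>A B. A + B), module.smult = (\<lambda>c A. coset_act J (scal c) A)\<rparr>"

text \<open>
  The left ideal \<open>M\<close> for which \<open>T/M\<close> is the quotient of \<open>T/J\<close> by the sum of all its proper
  submodules; proper submodules of \<open>T/J\<close> correspond to left ideals above \<open>J\<close> not containing 1.
\<close>

definition sum_of_proper :: "'g tensor set \<Rightarrow> 'g tensor set" where
  "sum_of_proper J = left_ideal_generated (\<Union>{K. left_ideal K \<and> J \<subseteq> K \<and> 1 \<notin> K})"


section \<open>Linear isomorphisms and sums with finitely many nonzero terms\<close>

definition linear_iso ::
    "(complex, 'v) module \<Rightarrow> (complex, 'w) module \<Rightarrow> ('v \<Rightarrow> 'w) \<Rightarrow> bool" where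
  "linear_iso V W \<Phi> \<longleftrightarrow>
     bij_betw \<Phi> (carrier V) (carrier W) \<and>
     (\<forall>x\<in>carrier V. \<forall>y\<in>carrier V. \<Phi> (x \<oplus>\<^bsub>V\<^esub> y) = \<Phi> x \<oplus>\<^bsub>W\<^esub> \<Phi> y) \<and>
     (\<forall>c. \<forall>x\<in>carrier V. \<Phi> (c \<odot>\<^bsub>V\<^esub> x) = c \<odot>\<^bsub>W\<^esub> \<Phi> x)"

definition fin_sum :: "(complex, 'w) module \<Rightarrow> ('i \<Rightarrow> 'w) \<Rightarrow> 'w" where
  "fin_sum W f = finsum W f {j. f j \<noteq> \<zero>\<^bsub>W\<^esub>}"


section \<open>The twisted Heisenberg-Virasoro algebra and its Verma modules\<close>

datatype hv = hvL int | hvI int | hvCL | hvCLI | hvCI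

fun hv_bracket :: "hv \<Rightarrow> hv \<Rightarrow> hv tensor" where
  "hv_bracket (hvL n) (hvL m) = scal (of_int (n - m)) * gen (hvL (n + m))
     + scal (if n = - m then (of_int n ^ 3 - of_int n) / 12 else 0) * gen hvCL"
| "hv_bracket (hvL n) (hvI m) = scal (- of_int m) * gen (hvI (n + m))
     - scal (if n = - m then of_int n ^ 2 + of_int n else 0) * gen hvCLI"
| "hv_bracket (hvI m) (hvL n) = - (scal (- of_int m) * gen (hvI (n + m))
     - scal (if n = - m then of_int n ^ 2 + of_int n else 0) * gen hvCLI)"
| "hv_bracket (hvI n) (hvI m) = scal (if n = - m then of_int n else 0) * gen hvCI"
| "hv_bracket _ _ = 0"

fun hv_nonneg :: "hv \<Rightarrow> bool" where
  "hv_nonneg (hvL n) \<longleftrightarrow> n \<ge> 0"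
| "hv_nonneg (hvI n) \<longleftrightarrow> n \<ge> 0"
| "hv_nonneg _ \<longleftrightarrow> True"

fun hv_weight :: "complex \<Rightarrow> complex \<Rightarrow> complex \<Rightarrow> complex \<Rightarrow> complex \<Rightarrow> hv \<Rightarrow> complex" where
  "hv_weight cL cI cLI h hI (hvL n) = (if n = 0 then h else 0)"
| "hv_weight cL cI cLI h hI (hvI n) = (if n = 0 then hI else 0)"
| "hv_weight cL cI cLI h hI hvCL = cL"
| "hv_weight cL cI cLI h hI hvCLI = cLI"
| "hv_weight cL cI cLI h hI hvCI = cI"

definition verma_ideal ::
    "complex \<Rightarrow> complex \<Rightarrow> complex \<Rightarrow> complex \<Rightarrow> complex \<Rightarrow> hv tensor set" where
  "verma_ideal cL cI cLI h hI =
     induced_ideal hv_bracket {x. hv_nonneg x} (hv_weight cL cI cLI h hI)"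

definition verma ::
    "complex \<Rightarrow> complex \<Rightarrow> complex \<Rightarrow> complex \<Rightarrow> complex \<Rightarrow> (complex, hv tensor set) module" where
  "verma cL cI cLI h hI = quotient_space (verma_ideal cL cI cLI h hI)"

definition verma_rep ::
    "complex \<Rightarrow> complex \<Rightarrow> complex \<Rightarrow> complex \<Rightarrow> complex \<Rightarrow> hv \<Rightarrow> hv tensor set \<Rightarrow> hv tensor set" where
  "verma_rep cL cI cLI h hI x = coset_act (verma_ideal cL cI cLI h hI) (gen x)"

definition hv_module_iso ::
    "(complex, 'v) module \<Rightarrow> (hv \<Rightarrow> 'v \<Rightarrow> 'v) \<Rightarrow> (complex, 'w) module \<Rightarrow> (hv \<Rightarrow> 'w \<Rightarrow> 'w) \<Rightarrow>
     ('v \<Rightarrow> 'w) \<Rightarrow> bool" where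
  "hv_module_iso V \<rho> W \<sigma> \<Phi> \<longleftrightarrow>
     linear_iso V W \<Phi> \<and> (\<forall>x. \<forall>v\<in>carrier V. \<Phi> (\<rho> x v) = \<sigma> x (\<Phi> v))"


section \<open>Fock spaces and the free field realization\<close>

datatype hbasis = Alpha | Beta

fun hform :: "hbasis \<Rightarrow> hbasis \<Rightarrow> complex" where
  "hform Alpha Alpha = 1"
| "hform Beta Beta = - 1"
| "hform _ _ = 0"

text \<open>\<open>Mode \<delta> n\<close> is \<open>\<delta>(n) = t\<^sup>n \<otimes> \<delta>\<close>, and \<open>Level\<close> is the central element \<open>c\<close>.\<close>

datatype haff = Mode hbasis int | Level

fun haff_bracket :: "haff \<Rightarrow> haff \<Rightarrow> haff tensor" where
  "haff_bracket (Mode \<delta> n) (Mode \<epsilon> m) =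
     scal (if n = - m then of_int n * hform \<delta> \<epsilon> else 0) * gen Level"
| "haff_bracket _ _ = 0"

fun haff_nonneg :: "haff \<Rightarrow> bool" where
  "haff_nonneg (Mode \<delta> n) \<longleftrightarrow> n \<ge> 0"
| "haff_nonneg Level \<longleftrightarrow> True"

text \<open>The weight \<open>\<gamma> = r \<alpha> + s \<beta>\<close>: \<open>\<delta>(0)\<close> acts as \<open>\<langle>\<delta>, \<gamma>\<rangle>\<close> and \<open>c\<close> as 1.\<close>

fun haff_weight :: "complex \<Rightarrow> complex \<Rightarrow> haff \<Rightarrow> complex" where
  "haff_weight r s (Mode \<delta> n) = (if n = 0 then r * hform \<delta> Alpha + s * hform \<delta> Beta else 0)"
| "haff_weight r s Level = 1"

definition fock_ideal :: "complex \<Rightarrow> complex \<Rightarrow> haff tensor set" where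
  "fock_ideal r s = induced_ideal haff_bracket {x. haff_nonneg x} (haff_weight r s)"

definition fock :: "complex \<Rightarrow> complex \<Rightarrow> (complex, haff tensor set) module" where
  "fock r s = quotient_space (fock_ideal r s)"

text \<open>
  A field \<open>A(z) = \<Sum>\<^sub>n A\<^sub>n z\<^sup>-\<^sup>n\<^sup>-\<^sup>1\<close> is given by its modes \<open>A n\<close>. The field \<open>Y(\<delta>(-1)1, z)\<close> on
  \<open>M(1,\<gamma>)\<close> is \<open>\<Sum>\<^sub>n \<delta>(n) z\<^sup>-\<^sup>n\<^sup>-\<^sup>1\<close>, \<open>Y(\<delta>(-2)1, z)\<close> is its derivative, and
  \<open>Y(\<delta>(-1)\<epsilon>(-1)1, z)\<close> is the normally ordered product of the fields of \<open>\<delta>\<close> and \<open>\<epsilon>\<close>.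
\<close>

type_synonym 'w field_modes = "int \<Rightarrow> 'w \<Rightarrow> 'w"

definition heis_field :: "complex \<Rightarrow> complex \<Rightarrow> hbasis \<Rightarrow> haff tensor set field_modes" where
  "heis_field r s \<delta> n = coset_act (fock_ideal r s) (gen (Mode \<delta> n))"

definition deriv_field :: "(complex, 'w) module \<Rightarrow> 'w field_modes \<Rightarrow> 'w field_modes" where
  "deriv_field W A n w = (- of_int n) \<odot>\<^bsub>W\<^esub> A (n - 1) w"

definition normal_product ::
    "(complex, 'w) module \<Rightarrow> 'w field_modes \<Rightarrow> 'w field_modes \<Rightarrow> 'w field_modes" where
  "normal_product W A B n w =
     fin_sum W (\<lambda>j::int. if j < 0 then A j (B (n - j - 1) w) else B (n - j - 1) (A j w))"

definition lam :: "complex \<Rightarrow> complex \<Rightarrow> complex" where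
  "lam cL cLI = (2 - cL) / (24 * cLI) + cLI / 2"

definition mu :: "complex \<Rightarrow> complex \<Rightarrow> complex" where
  "mu cL cLI = (2 - cL) / (24 * cLI) - cLI / 2"

definition Delta :: "complex \<Rightarrow> complex \<Rightarrow> complex \<Rightarrow> complex \<Rightarrow> complex" where
  "Delta cL cLI r s = r ^ 2 / 2 - s ^ 2 / 2 - lam cL cLI * r + mu cL cLI * s"

definition I_field :: "complex \<Rightarrow> complex \<Rightarrow> haff tensor set field_modes" where
  "I_field r s n w = heis_field r s Alpha n w \<oplus>\<^bsub>fock r s\<^esub> heis_field r s Beta n w"

definition omega_field ::
    "complex \<Rightarrow> complex \<Rightarrow> complex \<Rightarrow> complex \<Rightarrow> haff tensor set field_modes" where
  "omega_field cL cLI r s n w =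
     (let F = fock r s; a = heis_field r s Alpha; b = heis_field r s Beta in
        (1 / 2) \<odot>\<^bsub>F\<^esub> normal_product F a a n w
        \<oplus>\<^bsub>F\<^esub> (- 1 / 2) \<odot>\<^bsub>F\<^esub> normal_product F b b n w
        \<oplus>\<^bsub>F\<^esub> lam cL cLI \<odot>\<^bsub>F\<^esub> deriv_field F a n w
        \<oplus>\<^bsub>F\<^esub> mu cL cLI \<odot>\<^bsub>F\<^esub> deriv_field F b n w)"

text \<open>The shift in the index of \<open>L(n)\<close> comes from \<open>Y(\<omega>, z) = \<Sum>\<^sub>n L(n) z\<^sup>-\<^sup>n\<^sup>-\<^sup>2\<close>.\<close>

fun fock_rep ::
    "complex \<Rightarrow> complex \<Rightarrow> complex \<Rightarrow> complex \<Rightarrow> hv \<Rightarrow> haff tensor set \<Rightarrow> haff tensor set" where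
  "fock_rep cL cLI r s (hvL n) w = omega_field cL cLI r s (n + 1) w"
| "fock_rep cL cLI r s (hvI n) w = I_field r s n w"
| "fock_rep cL cLI r s hvCL w = cL \<odot>\<^bsub>fock r s\<^esub> w"
| "fock_rep cL cLI r s hvCLI w = cLI \<odot>\<^bsub>fock r s\<^esub> w"
| "fock_rep cL cLI r s hvCI w = 0 \<odot>\<^bsub>fock r s\<^esub> w"


section \<open>Vertex algebras and their modules\<close>

text \<open>
  \<open>Y a n\<close> is the mode \<open>a\<^sub>(\<^sub>n\<^sub>)\<close> in \<open>Y(a, z) = \<Sum>\<^sub>n a\<^sub>(\<^sub>n\<^sub>) z\<^sup>-\<^sup>n\<^sup>-\<^sup>1\<close>. Values of \<open>Y\<close> at arguments
  outside of the carriers are irrelevant.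
\<close>

definition state_field_map ::
    "(complex, 'v) module \<Rightarrow> (complex, 'w) module \<Rightarrow> ('v \<Rightarrow> 'w field_modes) \<Rightarrow> bool" where
  "state_field_map V W Y \<longleftrightarrow>
     (\<forall>a\<in>carrier V. \<forall>n. \<forall>w\<in>carrier W. Y a n w \<in> carrier W) \<and>
     (\<forall>a\<in>carrier V. \<forall>b\<in>carrier V. \<forall>n. \<forall>w\<in>carrier W. Y (a \<oplus>\<^bsub>V\<^esub> b) n w = Y a n w \<oplus>\<^bsub>W\<^esub> Y b n w) \<and>
     (\<forall>c. \<forall>a\<in>carrier V. \<forall>n. \<forall>w\<in>carrier W. Y (c \<odot>\<^bsub>V\<^esub> a) n w = c \<odot>\<^bsub>W\<^esub> Y a n w) \<and>
     (\<forall>a\<in>carrier V. \<forall>n. \<forall>w\<in>carrier W. \<forall>u\<in>carrier W. Y a n (w \<oplus>\<^bsub>W\<^esub> u) = Y a n w \<oplus>\<^bsub>W\<^esub> Y a n u) \<and>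
     (\<forall>c. \<forall>a\<in>carrier V. \<forall>n. \<forall>w\<in>carrier W. Y a n (c \<odot>\<^bsub>W\<^esub> w) = c \<odot>\<^bsub>W\<^esub> Y a n w) \<and>
     (\<forall>a\<in>carrier V. \<forall>w\<in>carrier W. \<exists>N. \<forall>n\<ge>N. Y a n w = \<zero>\<^bsub>W\<^esub>)"

text \<open>The Jacobi identity in its component form (Borcherds identity).\<close>

definition borcherds_identity ::
    "(complex, 'v) module \<Rightarrow> ('v \<Rightarrow> 'v field_modes) \<Rightarrow>
     (complex, 'w) module \<Rightarrow> ('v \<Rightarrow> 'w field_modes) \<Rightarrow> bool" where
  "borcherds_identity V Y W YW \<longleftrightarrow>
     (\<forall>a\<in>carrier V. \<forall>b\<in>carrier V. \<forall>w\<in>carrier W. \<forall>l m n :: int.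
        fin_sum W (\<lambda>j::nat. (of_int m gchoose j) \<odot>\<^bsub>W\<^esub> YW (Y a (l + int j) b) (m + n - int j) w) =
        fin_sum W (\<lambda>j::nat. ((- 1) ^ j * (of_int l gchoose j)) \<odot>\<^bsub>W\<^esub>
          (YW a (m + l - int j) (YW b (n + int j) w)
           \<ominus>\<^bsub>W\<^esub> ((- 1) powi l) \<odot>\<^bsub>W\<^esub> YW b (n + l - int j) (YW a (m + int j) w))))"

locale vertex_algebra =
  fixes V :: "(complex, 'v) module" and vac :: 'v and Y :: "'v \<Rightarrow> 'v field_modes"
  assumes space: "module complex_ring V"
    and vac_closed: "vac \<in> carrier V"
    and fields: "state_field_map V V Y"
    and vacuum: "\<And>n v. v \<in> carrier V \<Longrightarrow> Y vac n v = (if n = - 1 then v else \<zero>\<^bsub>V\<^esub>)"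
    and creation: "\<And>a. a \<in> carrier V \<Longrightarrow> Y a (- 1) vac = a"
    and creation_nonneg: "\<And>a n. a \<in> carrier V \<Longrightarrow> n \<ge> 0 \<Longrightarrow> Y a n vac = \<zero>\<^bsub>V\<^esub>"
    and borcherds: "borcherds_identity V Y V Y"

locale vertex_algebra_module =
  fixes V :: "(complex, 'v) module" and vac :: 'v and Y :: "'v \<Rightarrow> 'v field_modes"
    and W :: "(complex, 'w) module" and YW :: "'v \<Rightarrow> 'w field_modes"
  assumes algebra: "vertex_algebra V vac Y"
    and space: "module complex_ring W"
    and fields: "state_field_map V W YW"
    and vacuum: "\<And>n w. w \<in> carrier W \<Longrightarrow> YW vac n w = (if n = - 1 then w else \<zero>\<^bsub>W\<^esub>)"
    and borcherds: "borcherds_identity V Y W YW"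

definition va_module_iso ::
    "(complex, 'v) module \<Rightarrow> (complex, 'w) module \<Rightarrow> ('v \<Rightarrow> 'w field_modes) \<Rightarrow>
     (complex, 'u) module \<Rightarrow> ('v \<Rightarrow> 'u field_modes) \<Rightarrow> ('w \<Rightarrow> 'u) \<Rightarrow> bool" where
  "va_module_iso V W YW U YU \<Phi> \<longleftrightarrow>
     linear_iso W U \<Phi> \<and>
     (\<forall>a\<in>carrier V. \<forall>n. \<forall>w\<in>carrier W. \<Phi> (YW a n w) = YU a n (\<Phi> w))"


section \<open>The Heisenberg-Virasoro vertex algebra and its modules\<close>

definition LH_ideal :: "complex \<Rightarrow> complex \<Rightarrow> hv tensor set" where
  "LH_ideal cL cLI = sum_of_proper (verma_ideal cL 0 cLI 0 0)"

definition LH :: "complex \<Rightarrow> complex \<Rightarrow> (complex, hv tensor set) module" where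
  "LH cL cLI = quotient_space (LH_ideal cL cLI)"

definition LH_rep :: "complex \<Rightarrow> complex \<Rightarrow> hv \<Rightarrow> hv tensor set \<Rightarrow> hv tensor set" where
  "LH_rep cL cLI x = coset_act (LH_ideal cL cLI) (gen x)"

definition LH_vac :: "complex \<Rightarrow> complex \<Rightarrow> hv tensor set" where
  "LH_vac cL cLI = 1 +o LH_ideal cL cLI"

text \<open>
  On a space \<open>W\<close> with operators \<open>\<rho>\<close> representing the Heisenberg-Virasoro algebra, the states
  \<open>I(-1)1\<close> and \<open>L(-2)1\<close> have the fields \<open>\<Sum>\<^sub>n I(n) z\<^sup>-\<^sup>n\<^sup>-\<^sup>1\<close> and \<open>\<Sum>\<^sub>n L(n) z\<^sup>-\<^sup>n\<^sup>-\<^sup>2\<close>.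
\<close>

definition hv_fields ::
    "complex \<Rightarrow> complex \<Rightarrow> (complex, 'w) module \<Rightarrow> (hv \<Rightarrow> 'w \<Rightarrow> 'w) \<Rightarrow>
     (hv tensor set \<Rightarrow> 'w field_modes) \<Rightarrow> bool" where
  "hv_fields cL cLI W \<rho> YW \<longleftrightarrow>
     (\<forall>n. \<forall>w\<in>carrier W.
        YW (LH_rep cL cLI (hvI (- 1)) (LH_vac cL cLI)) n w = \<rho> (hvI n) w \<and>
        YW (LH_rep cL cLI (hvL (- 2)) (LH_vac cL cLI)) (n + 1) w = \<rho> (hvL n) w)"

text \<open>
  The vertex algebra structure of \<open>L\<^sup>H(c\<^sub>L, c\<^sub>L\<^sub>I)\<close>, and the structure of an
  \<open>L\<^sup>H(c\<^sub>L, c\<^sub>L\<^sub>I)\<close>-module on a Heisenberg-Virasoro module. Since \<open>I(-1)1\<close> and \<open>L(-2)1\<close>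
  generate, there is at most one such structure (on the carriers).
\<close>

definition LH_structure ::
    "complex \<Rightarrow> complex \<Rightarrow> (hv tensor set \<Rightarrow> hv tensor set field_modes) \<Rightarrow> bool" where
  "LH_structure cL cLI Y \<longleftrightarrow>
     vertex_algebra (LH cL cLI) (LH_vac cL cLI) Y \<and>
     hv_fields cL cLI (LH cL cLI) (LH_rep cL cLI) Y"

definition LH_module_structure ::
    "complex \<Rightarrow> complex \<Rightarrow> (hv tensor set \<Rightarrow> hv tensor set field_modes) \<Rightarrow>
     (complex, 'w) module \<Rightarrow> (hv \<Rightarrow> 'w \<Rightarrow> 'w) \<Rightarrow> (hv tensor set \<Rightarrow> 'w field_modes) \<Rightarrow> bool" where
  "LH_module_structure cL cLI Y W \<rho> YW \<longleftrightarrow>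
     vertex_algebra_module (LH cL cLI) (LH_vac cL cLI) Y W YW \<and>
     hv_fields cL cLI W \<rho> YW"

end

theory Submission
  imports Defs
begin

text \<open>
  Both modules are identified with the polynomial ring in variables \<open>x\<^sub>n\<close>, \<open>y\<^sub>n\<close>
  (\<open>n \<ge> 1\<close>), the creation operators \<open>(\<alpha> + \<beta>)(-n)\<close> and \<open>(\<alpha> - \<beta>)(-n)\<close> of the Fock space.
  There \<open>I(-n)\<close> is multiplication by \<open>x\<^sub>n\<close>, and \<open>L(-n)\<close> is multiplication by
  \<open>(h\<^sub>I + (n - 1) c\<^sub>L\<^sub>I) y\<^sub>n / 2\<close> plus terms which are lower if \<open>x\<^sub>n\<close> has weight \<open>0\<close> and
  \<open>y\<^sub>n\<close> has weight \<open>n + 1\<close>. The assumption says that these coefficients never vanish, so the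
  ordered monomials in the \<open>I(-n)\<close> and \<open>L(-n)\<close>, which span the Verma module, are mapped to
  the monomial basis by a triangular map. The vertex algebra module structures correspond
  because the Borcherds identity with \<open>m = 0\<close> expresses the field of \<open>a\<^sub>(\<^sub>l\<^sub>)b\<close>
  by those of \<open>a\<close> and \<open>b\<close>.
\<close>

text \<open>Giving \<open>y_n\<close> weight \<open>n + 1\<close> rather than \<open>n\<close> makes
  the commutator terms lower: \<open>L(-n)\<close> moved past \<open>y_k\<close> produces a multiple
  of \<open>y_(n+k)\<close>, of weight \<open>n + k + 1\<close>, against \<open>n + k + 2\<close>
  for \<open>y_n y_k\<close>. Isotropy matters for the same reason: the quadratic part of
  \<open>L(-n)\<close> consists of mixed products \<open>x_j y_k\<close> with
  \<open>j + k = n\<close>; a product \<open>y_j y_k\<close> would have weight \<open>n + 2\<close>,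
  above that of \<open>y_n\<close>. In the leading coefficient, \<open>h_I = r - s\<close> comes
  from the zero modes and \<open>(n - 1) c_LI\<close> from the derivative terms of the conformal
  vector.

  Only the spanning half of Poincare-Birkhoff-Witt is proved abstractly; independence is read off
  from the triangular action on the polynomial 1.

  The Virasoro relation on polynomials is not obtained by rearranging infinite normally ordered
  sums. Its defect commutes with every Heisenberg mode, so it vanishes once its value at 1 does, and
  that value is a scalar found from constant terms.

  No vertex algebra structure is built from scratch: a given one on the Fock space is carried over,
  and any other on the Verma module must agree with it.\<close>

abbreviation "lookup \<equiv> Poly_Mapping.lookup"
abbreviation "keys \<equiv> Poly_Mapping.keys"

section \<open>Finitely supported functions as a complex vector space, and linear maps between
  them\<close>

definition sc :: "complex \<Rightarrow> ('a \<Rightarrow>\<^sub>0 complex) \<Rightarrow> 'a \<Rightarrow>\<^sub>0 complex" where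
  "sc c p = Poly_Mapping.map ((*) c) p"

lemma lookup_sc [simp]: "lookup (sc c p) k = c * lookup p k"
  by (simp add: sc_def map.rep_eq when_def)

lemma lookup_double: "lookup (2 * p) k = 2 * lookup p k" for p :: "'a::monoid_add \<Rightarrow>\<^sub>0 complex"
  by (simp only: mult_2 lookup_add)

lemmas lookups = lookup_add lookup_minus lookup_uminus lookup_sc lookup_zero lookup_double

global_interpretation sc: vector_space sc
  by unfold_locales (auto intro!: poly_mapping_eqI simp: lookups algebra_simps)

lemma sc_single: "sc c (Poly_Mapping.single k d) = Poly_Mapping.single k (c * d)"
  by (rule poly_mapping_eqI) (simp add: lookup_single when_def)

lemma keys_sc: "keys (sc c p) \<subseteq> keys p"
  by (auto simp: in_keys_iff)

lemma poly_mapping_expand: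
  assumes "finite K" "keys p \<subseteq> K"
  shows "p = (\<Sum>k\<in>K. sc (lookup p k) (Poly_Mapping.single k 1))"
proof (rule poly_mapping_eqI)
  fix j
  have "(\<Sum>k\<in>K. lookup p k * lookup (Poly_Mapping.single k (1::complex)) j)
      = (\<Sum>k\<in>K. if k = j then lookup p j else 0)"
    by (rule sum.cong) (auto simp: lookup_single when_def)
  also have "\<dots> = lookup p j"
    using assms by (auto simp: sum.delta in_keys_iff)
  finally show "lookup p j = lookup (\<Sum>k\<in>K. sc (lookup p k) (Poly_Mapping.single k 1)) j"
    by (simp add: lookup_sum)
qed

lemma poly_mapping_add_induct [case_names single add]:
  assumes "\<And>k c. Q (Poly_Mapping.single k c)" "\<And>p q. Q p \<Longrightarrow> Q q \<Longrightarrow> Q (p + q)"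
  shows "Q (p :: 'a \<Rightarrow>\<^sub>0 complex)"
proof -
  have zero: "Q 0"
    using assms(1)[of undefined 0] by simp
  have "Q (\<Sum>k\<in>K. Poly_Mapping.single k (lookup p k))" if "finite K" for K
    using that by induction (auto intro: assms zero)
  from this[of "keys p"] show ?thesis
    using poly_mapping_expand[of "keys p" p] by (simp add: sc_single)
qed

lemma poly_mapping_lin_induct [case_names single add scale]:
  assumes "\<And>k. Q (Poly_Mapping.single k 1)"
    and "\<And>p q. Q p \<Longrightarrow> Q q \<Longrightarrow> Q (p + q)"
    and "\<And>c p. Q p \<Longrightarrow> Q (sc c p)"
  shows "Q (p :: 'a \<Rightarrow>\<^sub>0 complex)"
proof -
  have zero: "Q 0"
    using assms(3)[OF assms(1), of 0 undefined] by simp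
  have "Q (\<Sum>k\<in>K. sc (lookup p k) (Poly_Mapping.single k 1))" if "finite K" for K
    using that by induction (auto intro: assms zero)
  from this[of "keys p"] show ?thesis
    using poly_mapping_expand[of "keys p" p] by simp
qed

definition lin :: "(('a \<Rightarrow>\<^sub>0 complex) \<Rightarrow> 'b \<Rightarrow>\<^sub>0 complex) \<Rightarrow> bool" where
  "lin f \<longleftrightarrow> (\<forall>p q. f (p + q) = f p + f q) \<and> (\<forall>c p. f (sc c p) = sc c (f p))"

lemma linI: "(\<And>p q. f (p + q) = f p + f q) \<Longrightarrow> (\<And>c p. f (sc c p) = sc c (f p)) \<Longrightarrow> lin f"
  by (simp add: lin_def)

lemma lin_add: "lin f \<Longrightarrow> f (p + q) = f p + f q"
  and lin_sc: "lin f \<Longrightarrow> f (sc c p) = sc c (f p)"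
  by (simp_all add: lin_def)

lemma lin_zero: "lin f \<Longrightarrow> f 0 = 0"
  using lin_sc[of f 0 0] by simp

lemma lin_uminus: "lin f \<Longrightarrow> f (- p) = - f p"
  using lin_sc[of f "-1" p] by (simp add: sc.scale_minus_left)

lemma lin_diff: "lin f \<Longrightarrow> f (p - q) = f p - f q"
  using lin_add[of f p "- q"] lin_uminus[of f q] by simp

lemmas lin_simps = lin_add lin_sc lin_zero lin_uminus lin_diff

lemma lin_sum: "lin f \<Longrightarrow> f (sum g A) = (\<Sum>a\<in>A. f (g a))"
  by (induction A rule: infinite_finite_induct) (simp_all add: lin_simps)

lemma lin_eqI:
  assumes "lin f" "lin g" "\<And>k. f (Poly_Mapping.single k 1) = g (Poly_Mapping.single k 1)"
  shows "f p = g p"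
  by (induction p rule: poly_mapping_lin_induct) (simp_all add: assms lin_simps)

lemma lin_comp: "lin f \<Longrightarrow> lin g \<Longrightarrow> lin (\<lambda>p. f (g p))"
  by (simp add: lin_def)

lemma lin_plus: "lin f \<Longrightarrow> lin g \<Longrightarrow> lin (\<lambda>p. f p + g p)"
  and lin_scale: "lin f \<Longrightarrow> lin (\<lambda>p. sc c (f p))"
  by (auto intro!: linI simp: lin_simps sc.scale_right_distrib sc.scale_right_diff_distrib mult.commute)

lemma lin_id: "lin (\<lambda>p. p)"
  by (simp add: lin_def)

text \<open>The linear map with prescribed values on the basis vectors
  \<open>single k 1\<close>.\<close>

definition ext :: "('a \<Rightarrow> 'b \<Rightarrow>\<^sub>0 complex) \<Rightarrow> ('a \<Rightarrow>\<^sub>0 complex) \<Rightarrow> 'b \<Rightarrow>\<^sub>0 complex" where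
  "ext f p = (\<Sum>k\<in>keys p. sc (lookup p k) (f k))"

lemma ext_superset:
  assumes "finite K" "keys p \<subseteq> K"
  shows "ext f p = (\<Sum>k\<in>K. sc (lookup p k) (f k))"
  unfolding ext_def using assms by (intro sum.mono_neutral_left) (auto simp: in_keys_iff)

lemma lin_ext: "lin (ext f)"
proof (rule linI)
  fix p q :: "'a \<Rightarrow>\<^sub>0 complex" and c
  define K where "K = keys p \<union> keys q"
  have K: "finite K" "keys p \<subseteq> K" "keys q \<subseteq> K" "keys (p + q) \<subseteq> K"
    using Poly_Mapping.keys_add[of p q] by (auto simp: K_def)
  show "ext f (p + q) = ext f p + ext f q"
    by (simp add: ext_superset[OF K(1)] K lookup_add sc.scale_left_distrib sum.distrib)
  show "ext f (sc c p) = sc c (ext f p)"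
    using keys_sc[of c p] K(2) by (simp add: ext_superset[OF K(1)] sc.scale_sum_right)
qed

lemma ext_single [simp]: "ext f (Poly_Mapping.single k 1) = f k"
  by (simp add: ext_def)

section \<open>Representations of the tensor algebra\<close>

abbreviation wrd :: "'g list \<Rightarrow> 'g tensor" where
  "wrd w \<equiv> Poly_Mapping.single w 1"

lemma wrd_Nil: "wrd [] = 1"
  by (metis single_one zero_list_def)

lemma scal_mult: "scal c * t = sc c t"
  by (induction t rule: poly_mapping_add_induct)
     (simp_all add: scal_def mult_single plus_list_def sc_single algebra_simps sc.scale_right_distrib)

lemma sc_mult_left: "sc c s * t = sc c (s * t)" for s t :: "'g tensor"
  by (simp add: scal_mult[symmetric] mult.assoc)

lemma sc_mult_right: "s * sc c t = sc c (s * t)" for s t :: "'g tensor"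
proof -
  have "s * scal c = scal c * s" for s :: "'g tensor"
    by (induction s rule: poly_mapping_add_induct)
       (simp_all add: scal_def mult_single plus_list_def algebra_simps)
  then show ?thesis
    by (metis scal_mult mult.assoc)
qed

lemma wrd_Cons: "wrd (x # w) = gen x * wrd w"
  by (simp add: gen_def mult_single plus_list_def)

lemma tensor_induct [case_names one gen add scale]:
  assumes "Q 1" "\<And>x t. Q t \<Longrightarrow> Q (gen x * t)"
    and "\<And>p q. Q p \<Longrightarrow> Q q \<Longrightarrow> Q (p + q)"
    and "\<And>c p. Q p \<Longrightarrow> Q (sc c p)"
  shows "Q (t :: 'g tensor)"
proof (induction t rule: poly_mapping_lin_induct)
  case (single k)
  show ?case by (induction k) (auto simp: wrd_Nil wrd_Cons assms)
qed (use assms in auto)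

text \<open>The representation of the tensor algebra that extends the operators
  \<open>\<rho> x\<close>: a word acts by the composition of its letters, the rightmost one
  first.\<close>

definition act :: "('g \<Rightarrow> ('b \<Rightarrow>\<^sub>0 complex) \<Rightarrow> ('b \<Rightarrow>\<^sub>0 complex)) \<Rightarrow> 'g tensor \<Rightarrow> ('b \<Rightarrow>\<^sub>0 complex) \<Rightarrow> ('b \<Rightarrow>\<^sub>0 complex)"
  where "act \<rho> t p = ext (\<lambda>w. foldr \<rho> w p) t"

lemma lin_act: "lin (\<lambda>t. act \<rho> t p)"
  unfolding act_def by (rule lin_ext)

lemma act_one [simp]: "act \<rho> 1 p = p"
  by (simp add: act_def wrd_Nil[symmetric])

lemma act_gen_mult:
  assumes "\<And>x. lin (\<rho> x)"
  shows "act \<rho> (gen x * t) p = \<rho> x (act \<rho> t p)"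
proof -
  have 1: "lin (\<lambda>t. act \<rho> (gen x * t) p)"
    by (intro linI) (simp_all add: distrib_left sc_mult_right lin_add[OF lin_act] lin_sc[OF lin_act])
  have 2: "lin (\<lambda>t. \<rho> x (act \<rho> t p))"
    by (rule lin_comp[where f = "\<rho> x"]) (rule assms lin_act)+
  show ?thesis
    by (rule lin_eqI[OF 1 2]) (simp add: wrd_Cons[symmetric], simp add: act_def)
qed

lemma act_gen [simp]: "act \<rho> (gen x) p = \<rho> x p"
  by (simp add: act_def gen_def)

lemma act_scal [simp]: "act \<rho> (scal c) p = sc c p"
  using lin_sc[OF lin_act[of \<rho> p], of c 1] by (simp flip: scal_mult)

lemma act_add: "act \<rho> (s + t) p = act \<rho> s p + act \<rho> t p"
  and act_sc: "act \<rho> (sc c t) p = sc c (act \<rho> t p)"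
  and act_diff: "act \<rho> (s - t) p = act \<rho> s p - act \<rho> t p"
  and act_uminus: "act \<rho> (- t) p = - act \<rho> t p"
  and act_zero: "act \<rho> 0 p = 0"
  by (rule lin_simps[OF lin_act])+

lemma lin_act_right:
  assumes "\<And>x. lin (\<rho> x)"
  shows "lin (act \<rho> t)"
proof (induction t rule: tensor_induct)
  case one
  show ?case by (simp add: lin_id lin_def)
next
  case (gen x t)
  then show ?case
    using assms[of x] by (simp add: act_gen_mult[OF assms] lin_def)
next
  case (add p q)
  then show ?case using lin_plus[OF add] by (simp add: act_add lin_def)
next
  case (scale c p)
  then show ?case using lin_scale[OF scale] by (simp add: act_sc lin_def)
qed

lemma act_mult:
  assumes "\<And>x. lin (\<rho> x)"
  shows "act \<rho> (s * t) p = act \<rho> s (act \<rho> t p)"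
  by (induction s rule: tensor_induct)
     (simp_all add: act_gen_mult[OF assms] mult.assoc distrib_right act_add sc_mult_left act_sc)

section \<open>Quotients by left ideals\<close>

lemma left_idealD:
  assumes "left_ideal J"
  shows "0 \<in> J" "x \<in> J \<Longrightarrow> y \<in> J \<Longrightarrow> x + y \<in> J" "x \<in> J \<Longrightarrow> t * x \<in> J"
    "x \<in> J \<Longrightarrow> - x \<in> J" "x \<in> J \<Longrightarrow> y \<in> J \<Longrightarrow> x - y \<in> J" "x \<in> J \<Longrightarrow> sc c x \<in> J"
proof -
  show 1: "0 \<in> J" "\<And>x y. x \<in> J \<Longrightarrow> y \<in> J \<Longrightarrow> x + y \<in> J" "\<And>x t. x \<in> J \<Longrightarrow> t * x \<in> J"
    using assms by (auto simp: left_ideal_def)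
  show 2: "- x \<in> J" if "x \<in> J" for x
    using 1(3)[OF that, of "-1"] by simp
  show "x - y \<in> J" if "x \<in> J" "y \<in> J" for x y
    using 1(2)[OF that(1) 2[OF that(2)]] by simp
  show "sc c x \<in> J" if "x \<in> J" for c x
    using 1(3)[OF that, of "scal c"] by (simp add: scal_mult)
qed

lemma left_ideal_generated: "left_ideal (left_ideal_generated S)"
  by (auto simp: left_ideal_generated_def left_ideal_def)

lemma left_ideal_generated_superset: "S \<subseteq> left_ideal_generated S"
  by (auto simp: left_ideal_generated_def)

lemma left_ideal_generated_least: "left_ideal K \<Longrightarrow> S \<subseteq> K \<Longrightarrow> left_ideal_generated S \<subseteq> K"
  by (auto simp: left_ideal_generated_def)

lemma left_ideal_induced_ideal: "left_ideal (induced_ideal br Q \<chi>)"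
  by (simp add: induced_ideal_def left_ideal_generated)

lemma induced_ideal_bracket:
  "(gen x * gen y - gen y * gen x - br x y) * t \<in> induced_ideal br Q \<chi>"
  unfolding induced_ideal_def by (rule subsetD[OF left_ideal_generated_superset]) blast

lemma induced_ideal_character: "x \<in> Q \<Longrightarrow> gen x - scal (\<chi> x) \<in> induced_ideal br Q \<chi>"
  unfolding induced_ideal_def by (rule subsetD[OF left_ideal_generated_superset]) blast

text \<open>The universal property of the induced module. The annihilator of \<open>v\<close> is a
  left ideal, so only generators need checking; the right factor \<open>t\<close> in a bracket
  generator is harmless because \<open>br\<close> is assumed at every vector, in particular at
  \<open>act \<rho> t v\<close>.\<close>

lemma induced_ideal_annihilates:
  assumes "\<And>x. lin (\<rho> x)"
    and br: "\<And>x y p. \<rho> x (\<rho> y p) - \<rho> y (\<rho> x p) = act \<rho> (br x y) p"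
    and \<chi>: "\<And>x. x \<in> Q \<Longrightarrow> \<rho> x v = sc (\<chi> x) v"
    and "t \<in> induced_ideal br Q \<chi>"
  shows "act \<rho> t v = 0"
proof -
  have "left_ideal {t. act \<rho> t v = 0}"
    by (auto simp: left_ideal_def act_add act_zero act_mult[OF assms(1)] lin_zero[OF lin_act_right[OF assms(1)]])
  moreover have "act \<rho> ((gen x * gen y - gen y * gen x - br x y) * t) v = 0" for x y t
    by (simp add: act_mult[OF assms(1)] act_diff act_gen_mult[OF assms(1)] br)
  moreover have "act \<rho> (gen x - scal (\<chi> x)) v = 0" if "x \<in> Q" for x
    by (simp add: act_diff \<chi>[OF that])
  ultimately have "induced_ideal br Q \<chi> \<subseteq> {t. act \<rho> t v = 0}"
    unfolding induced_ideal_def by (intro left_ideal_generated_least) auto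
  then show ?thesis using assms(4) by auto
qed

lemma coset_iff: "a \<in> x +o J \<longleftrightarrow> a - x \<in> J" for x :: "'g tensor"
  by (auto simp: elt_set_plus_def) (metis add.commute diff_add_cancel)

lemma coset_eq_iff:
  assumes "left_ideal J"
  shows "x +o J = y +o J \<longleftrightarrow> x - y \<in> J"
proof
  assume "x +o J = y +o J"
  then have "x \<in> y +o J" using coset_iff[of x x J] left_idealD(1)[OF assms] by simp
  then show "x - y \<in> J" by (simp add: coset_iff)
next
  assume *: "x - y \<in> J"
  have "a - x \<in> J \<longleftrightarrow> a - y \<in> J" for a
    using left_idealD(2)[OF assms _ *, of "a - x"] left_idealD(5)[OF assms _ *, of "a - y"] by auto
  then show "x +o J = y +o J" by (auto simp: coset_iff)
qed

lemma coset_add: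
  assumes "left_ideal J"
  shows "(x +o J) + (y +o J) = (x + y) +o J"
proof safe
  fix a assume "a \<in> (x +o J) + (y +o J)"
  then obtain b c where "a = b + c" "b - x \<in> J" "c - y \<in> J"
    by (auto simp: set_plus_def coset_iff)
  then show "a \<in> (x + y) +o J"
    using left_idealD(2)[OF assms, of "b - x" "c - y"] by (simp add: coset_iff algebra_simps)
next
  fix a assume "a \<in> (x + y) +o J"
  then have "a - y \<in> x +o J" "y \<in> y +o J"
    using left_idealD(1)[OF assms] by (simp_all add: coset_iff algebra_simps)
  then show "a \<in> (x +o J) + (y +o J)"
    by (metis diff_add_cancel set_plus_intro)
qed

lemma coset_act_coset:
  assumes "left_ideal J"
  shows "coset_act J t (x +o J) = (t * x) +o J"
proof safe
  fix a assume "a \<in> coset_act J t (x +o J)"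
  then obtain b c where "a = t * b + c" "b - x \<in> J" "c \<in> J"
    by (auto simp: coset_act_def set_plus_def elt_set_times_def coset_iff)
  then show "a \<in> (t * x) +o J"
    using left_idealD(2)[OF assms left_idealD(3)[OF assms, of "b - x" t], of c]
    by (simp add: coset_iff algebra_simps)
next
  fix a assume "a \<in> (t * x) +o J"
  then have "a - t * x \<in> J" "x \<in> x +o J"
    using left_idealD(1)[OF assms] by (simp_all add: coset_iff)
  then have "t * x + (a - t * x) \<in> coset_act J t (x +o J)"
    unfolding coset_act_def by (intro set_plus_intro set_times_intro2)
  then show "a \<in> coset_act J t (x +o J)" by simp
qed

lemma quotient_space_simps:
  "carrier (quotient_space J) = range (\<lambda>x. x +o J)"
  "zero (quotient_space J) = J"
  "add (quotient_space J) A B = A + B"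
  "module.smult (quotient_space J) c A = coset_act J (scal c) A"
  by (simp_all add: quotient_space_def)

lemma zero_coset: "0 +o J = J" for J :: "'g tensor set"
  by (auto simp: elt_set_plus_def)

lemma module_quotient_space:
  assumes J: "left_ideal J"
  shows "module complex_ring (quotient_space J)"
proof (rule moduleI)
  show "cring (complex_ring)" by (rule cring_from_type_algebra)
  show "abelian_group (quotient_space J)"
  proof (rule abelian_groupI, goal_cases)
    case (6 x)
    then obtain y where "x = y +o J" by (auto simp: quotient_space_simps)
    then show ?case
      by (intro bexI[of _ "(- y) +o J"]) (auto simp: quotient_space_simps coset_add[OF J] zero_coset)
  next
    case 2
    show ?case by (auto simp: quotient_space_simps intro!: image_eqI[of _ _ 0] zero_coset[symmetric])
  next
    case (5 x)
    then show ?case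
      using coset_add[OF J, of 0] by (auto simp: quotient_space_simps zero_coset)
  qed (auto simp: quotient_space_simps coset_add[OF J] add_ac)
qed (auto simp: quotient_space_simps coset_add[OF J] coset_act_coset[OF J] ring_of_type_algebra_def
      scal_mult sc.scale_left_distrib sc.scale_right_distrib)

section \<open>A spanning set and a criterion for induced modules\<close>

text \<open>The set is the sum of \<open>J\<close> and \<open>sc.span S\<close>, that is, the
  preimage of the span of the cosets of \<open>S\<close> in the quotient by
  \<open>J\<close>.\<close>

lemma left_ideal_plus_span:
  assumes "left_ideal J"
  shows "sc.subspace {t. \<exists>j\<in>J. t - j \<in> sc.span S}"
proof (rule sc.subspaceI)
  show "0 \<in> {t. \<exists>j\<in>J. t - j \<in> sc.span S}"
    using left_idealD(1)[OF assms] by (auto intro!: bexI[of _ 0] sc.span_zero)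
next
  fix x y assume "x \<in> {t. \<exists>j\<in>J. t - j \<in> sc.span S}" "y \<in> {t. \<exists>j\<in>J. t - j \<in> sc.span S}"
  then obtain i j where "i \<in> J" "j \<in> J" "x - i \<in> sc.span S" "y - j \<in> sc.span S" by auto
  then show "x + y \<in> {t. \<exists>j\<in>J. t - j \<in> sc.span S}"
    using sc.span_add[of "x - i" S "y - j"] left_idealD(2)[OF assms]
    by (auto intro!: bexI[of _ "i + j"] simp: algebra_simps)
next
  fix c x assume "x \<in> {t. \<exists>j\<in>J. t - j \<in> sc.span S}"
  then obtain i where "i \<in> J" "x - i \<in> sc.span S" by auto
  then show "sc c x \<in> {t. \<exists>j\<in>J. t - j \<in> sc.span S}"
    using sc.span_scale[of "x - i" S c] left_idealD(6)[OF assms]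
    by (auto intro!: bexI[of _ "sc c i"] simp: sc.scale_right_diff_distrib)
qed

text \<open>
  The spanning half of the Poincare-Birkhoff-Witt theorem: modulo shorter words letters commute,
  and a letter acting on the cyclic vector by a scalar can be moved to the end of the word.
\<close>

locale straightening =
  fixes J :: "'g tensor set" and G :: "'v \<Rightarrow> 'g tensor" and K :: "'g tensor set"
    and wd :: "'v multiset \<Rightarrow> 'v list"
  assumes J: "left_ideal J"
    and commutator: "\<And>x y. x \<in> range G \<union> K \<Longrightarrow> y \<in> range G \<union> K \<Longrightarrow>
      \<exists>z\<in>sc.span (range G \<union> K). \<forall>t. (x * y - y * x - z) * t \<in> J"
    and character: "\<And>k. k \<in> K \<Longrightarrow> \<exists>c. k - scal c \<in> J"
    and generators: "\<And>x. gen x \<in> sc.span (range G \<union> K)"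
    and mset_wd: "\<And>N. mset (wd N) = N"
begin

text \<open>The Poincare-Birkhoff-Witt monomial of content \<open>N\<close>. No order on the letters
  is needed: one fixed word per multiset is enough.\<close>

definition ordered :: "'v multiset \<Rightarrow> 'g tensor" where
  "ordered N = prod_list (map G (wd N))"

text \<open>The strict bound makes \<open>short k\<close> the error allowed when a word of length
  \<open>k\<close> is rearranged.\<close>

definition short :: "nat \<Rightarrow> 'g tensor set" where
  "short k = {t. \<exists>j\<in>J. t - j \<in> sc.span (ordered ` {N. size N < k})}"

lemma subspace_short: "sc.subspace (short k)"
  unfolding short_def by (rule left_ideal_plus_span[OF J])

lemma ideal_subset_short: "J \<subseteq> short k"
  by (auto simp: short_def intro!: bexI sc.span_zero)

lemma short_mono: "k \<le> l \<Longrightarrow> short k \<subseteq> short l"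
proof
  fix t assume kl: "k \<le> l" and "t \<in> short k"
  then obtain j where "j \<in> J" "t - j \<in> sc.span (ordered ` {N. size N < k})"
    by (auto simp: short_def)
  moreover have "sc.span (ordered ` {N. size N < k}) \<subseteq> sc.span (ordered ` {N. size N < l})"
    using kl by (intro sc.span_mono) auto
  ultimately show "t \<in> short l" by (auto simp: short_def)
qed

lemma short_add: "s \<in> short k \<Longrightarrow> t \<in> short k \<Longrightarrow> s + t \<in> short k"
  using sc.subspace_add[OF subspace_short] .

lemma short_trans: "s - t \<in> short k \<Longrightarrow> t - u \<in> short k \<Longrightarrow> s - u \<in> short k"
  using short_add[of "s - t" k "t - u"] by simp

lemma short_cancel: "s - t \<in> short k \<Longrightarrow> t \<in> short k \<Longrightarrow> s \<in> short k"
  using short_add[of "s - t" k t] by simp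

text \<open>Induction on the length bound. For words of length \<open>k\<close> every rearrangement
  changes the product by an element of \<open>short k\<close>; afterwards either a letter of
  \<open>K\<close> stands last and becomes a scalar, or the word has been brought into the chosen
  form.\<close>

lemma words_short:
  "set us \<subseteq> range G \<union> K \<Longrightarrow> length us < k \<Longrightarrow> prod_list us \<in> short k"
proof (induction k arbitrary: us)
  case (Suc k)
  note IH = Suc.IH
  let ?\<Lambda> = "range G \<union> K"
  \<comment> \<open>A commutator replaces two letters by a combination of single letters, so the
    words obtained are shorter and the induction hypothesis applies.\<close>
  have mid: "prod_list us * z * prod_list vs \<in> short k"
    if "z \<in> sc.span ?\<Lambda>" "set us \<subseteq> ?\<Lambda>" "set vs \<subseteq> ?\<Lambda>" "length us + length vs + 1 < k" for us vs z
    using that(1)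
  proof (induction z rule: sc.span_induct_alt)
    case base
    show ?case by (simp add: sc.subspace_0[OF subspace_short])
  next
    case (step c x y)
    have "prod_list (us @ [x] @ vs) \<in> short k"
      using that step(1) by (intro IH) auto
    then have "prod_list us * x * prod_list vs \<in> short k"
      by (simp add: mult.assoc)
    moreover have "prod_list us * (sc c x + y) * prod_list vs
        = sc c (prod_list us * x * prod_list vs) + prod_list us * y * prod_list vs"
      by (simp add: algebra_simps sc_mult_left sc_mult_right)
    ultimately show ?case
      using step(2) by (simp add: short_add sc.subspace_scale[OF subspace_short])
  qed
  \<comment> \<open>The quantifier over \<open>t\<close> in \<open>commutator\<close> is used here
    with the tail of the word as \<open>t\<close>; the head is absorbed because \<open>J\<close> is
    a left ideal.\<close>
  have swap: "prod_list (us @ [x, y] @ vs) - prod_list (us @ [y, x] @ vs) \<in> short k"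
    if sw: "set us \<subseteq> ?\<Lambda>" "set vs \<subseteq> ?\<Lambda>" "x \<in> ?\<Lambda>" "y \<in> ?\<Lambda>" "length us + length vs + 1 < k" for us vs x y
  proof -
    obtain z where z: "z \<in> sc.span ?\<Lambda>" "\<And>t. (x * y - y * x - z) * t \<in> J"
      using commutator[OF sw(3,4)] by blast
    have "prod_list us * ((x * y - y * x - z) * prod_list vs) \<in> short k"
      using left_idealD(3)[OF J z(2)] ideal_subset_short by blast
    moreover have "prod_list us * z * prod_list vs \<in> short k"
      using z(1) sw by (intro mid)
    ultimately have "prod_list us * ((x * y - y * x - z) * prod_list vs)
        + prod_list us * z * prod_list vs \<in> short k"
      by (rule short_add)
    then show ?thesis by (simp add: algebra_simps)
  qed
  have bubble: "prod_list (pre @ us @ [x] @ vs) - prod_list (pre @ [x] @ us @ vs) \<in> short k"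
    if "set pre \<union> set us \<union> set vs \<subseteq> ?\<Lambda>" "x \<in> ?\<Lambda>"
      "length pre + length us + length vs < k" for pre us vs x
    using that
  proof (induction us arbitrary: pre)
    case Nil
    show ?case by (simp add: sc.subspace_0[OF subspace_short])
  next
    case (Cons y us)
    have "prod_list ((pre @ [y]) @ us @ [x] @ vs) - prod_list ((pre @ [y]) @ [x] @ us @ vs) \<in> short k"
      using Cons.prems by (intro Cons.IH) auto
    then have 1: "prod_list (pre @ (y # us) @ [x] @ vs) - prod_list (pre @ [y, x] @ us @ vs) \<in> short k"
      by (simp add: mult.assoc)
    have 2: "prod_list (pre @ [y, x] @ us @ vs) - prod_list (pre @ [x, y] @ us @ vs) \<in> short k"
      using Cons.prems by (intro swap) auto
    from short_trans[OF 1 2] show ?case by (simp add: mult.assoc)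
  qed
  \<comment> \<open>The first letter of \<open>us\<close> is located in \<open>vs\<close> and
    bubbled to the front; it then joins the prefix \<open>pre\<close>, which stays fixed.\<close>
  have perm: "prod_list (pre @ us) - prod_list (pre @ vs) \<in> short k"
    if "mset us = mset vs" "set pre \<union> set us \<subseteq> ?\<Lambda>" "length pre + length us \<le> k" for pre us vs
    using that
  proof (induction us arbitrary: pre vs)
    case Nil
    then show ?case by (simp add: sc.subspace_0[OF subspace_short])
  next
    case (Cons x us)
    have "x \<in> set vs" using Cons.prems(1) by (metis list.set_intros(1) set_mset_mset)
    then obtain a b where vs: "vs = a @ x # b" by (meson split_list)
    have ms: "mset us = mset (a @ b)" using Cons.prems(1) by (simp add: vs)
    then have sets: "set us = set (a @ b)" "length us = length (a @ b)"
      by (metis set_mset_mset, metis size_mset)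
    have "prod_list ((pre @ [x]) @ us) - prod_list ((pre @ [x]) @ (a @ b)) \<in> short k"
      using Cons.prems by (intro Cons.IH ms) auto
    then have 1: "prod_list (pre @ x # us) - prod_list (pre @ [x] @ a @ b) \<in> short k"
      by (simp add: mult.assoc)
    have "prod_list (pre @ a @ [x] @ b) - prod_list (pre @ [x] @ a @ b) \<in> short k"
      using Cons.prems sets by (intro bubble) auto
    from sc.subspace_neg[OF subspace_short this]
    have 2: "prod_list (pre @ [x] @ a @ b) - prod_list (pre @ vs) \<in> short k"
      by (simp add: vs mult.assoc)
    from short_trans[OF 1 2] show ?case .
  qed
  show ?case
  proof (cases "length us < k")
    case True
    then show ?thesis using IH[OF Suc.prems(1)] short_mono[of k "Suc k"] by auto
  next
    case False
    then have len: "length us = k" using Suc.prems by simp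
    show ?thesis
    proof (cases "set us \<inter> K = {}")
      \<comment> \<open>The letter from \<open>K\<close> is moved to the right end, where
        \<open>x - scal c\<close> lies in the left ideal, so the word loses one letter up to a
        scalar.\<close>
      case False
      then obtain x where x: "x \<in> set us" "x \<in> K" by auto
      then obtain a b where us: "us = a @ x # b" by (meson split_list)
      obtain c where c: "x - scal c \<in> J" using character[OF x(2)] by auto
      have "prod_list ([] @ us) - prod_list ([] @ ((a @ b) @ [x])) \<in> short k"
        using Suc.prems len by (intro perm) (auto simp: us)
      then have 1: "prod_list us - prod_list (a @ b) * x \<in> short k" by (simp add: mult.assoc)
      have "prod_list (a @ b) \<in> short k"
        using Suc.prems us len by (intro IH) auto
      then have "sc c (prod_list (a @ b)) \<in> short k"
        by (rule sc.subspace_scale[OF subspace_short])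
      moreover have "prod_list (a @ b) * (x - scal c) \<in> short k"
        using left_idealD(3)[OF J c] ideal_subset_short by blast
      moreover have "prod_list (a @ b) * scal c = sc c (prod_list (a @ b))"
        using sc_mult_right[of "prod_list (a @ b)" c 1] by (simp flip: scal_mult)
      ultimately have "prod_list (a @ b) * x \<in> short k"
        using short_add[of "prod_list (a @ b) * (x - scal c)" k "sc c (prod_list (a @ b))"]
        by (simp add: right_diff_distrib)
      then have "prod_list us \<in> short k" using short_cancel[OF 1] by simp
      then show ?thesis using short_mono[of k "Suc k"] by auto
    next
      case True
      then have "set us \<subseteq> range G" using Suc.prems by auto
      then obtain vs where vs: "us = map G vs" by (metis ex_map_conv image_iff subsetD)
      have "mset us = mset (map G (wd (mset vs)))"
        by (simp add: vs mset_wd)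
      then have "prod_list ([] @ us) - prod_list ([] @ map G (wd (mset vs))) \<in> short k"
        using Suc.prems len by (intro perm) auto
      then have "prod_list us - ordered (mset vs) \<in> short (Suc k)"
        using short_mono[of k "Suc k"] by (auto simp: ordered_def)
      moreover have "ordered (mset vs) \<in> short (Suc k)"
        using len by (auto simp: short_def vs intro!: bexI[of _ 0] sc.span_base left_idealD(1)[OF J])
      ultimately show ?thesis by (rule short_cancel)
    qed
  qed
qed simp

text \<open>A generator need not be a letter, only a combination of letters. A tensor is therefore
  built up by left multiplication with generators, each of which is expanded into letters; a letter
  times an ordered monomial is again a word in letters.\<close>

theorem ordered_spans: "\<exists>j\<in>J. t - j \<in> sc.span (range ordered)"
proof -
  let ?W = "{t. \<exists>j\<in>J. t - j \<in> sc.span (range ordered)}"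
  have W: "sc.subspace ?W" by (rule left_ideal_plus_span[OF J])
  have words: "prod_list us \<in> ?W" if "set us \<subseteq> range G \<union> K" for us
  proof -
    have "prod_list us \<in> short (Suc (length us))" using that by (intro words_short) auto
    moreover have "sc.span (ordered ` {N. size N < Suc (length us)}) \<subseteq> sc.span (range ordered)"
      by (rule sc.span_mono) auto
    ultimately show ?thesis by (auto simp: short_def)
  qed
  have letter: "x * t \<in> ?W" if "x \<in> range G \<union> K" "t \<in> ?W" for x t
  proof -
    from that(2) obtain j where j: "j \<in> J" "t - j \<in> sc.span (range ordered)" by auto
    have "x * s \<in> ?W" if "s \<in> sc.span (range ordered)" for s
      using that
    proof (induction s rule: sc.span_induct_alt)
      case base
      show ?case using sc.subspace_0[OF W] by simp
    next
      case (step c b y)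
      then obtain N where "b = ordered N" by auto
      then have "x * b \<in> ?W"
        using words[of "x # map G (wd N)"] \<open>x \<in> range G \<union> K\<close> by (auto simp: ordered_def)
      moreover have "x * (sc c b + y) = sc c (x * b) + x * y"
        by (simp add: distrib_left sc_mult_right)
      ultimately show ?case
        using sc.subspace_add[OF W sc.subspace_scale[OF W]] step(2) by simp
    qed
    from this[OF j(2)] have "x * (t - j) \<in> ?W" .
    moreover have "x * j \<in> ?W"
      using left_idealD(3)[OF J j(1)] by (auto intro!: bexI[of _ "x * j"] sc.span_zero)
    ultimately have "x * (t - j) + x * j \<in> ?W" by (rule sc.subspace_add[OF W])
    then show ?thesis by (simp add: right_diff_distrib)
  qed
  have "t \<in> ?W"
  proof (induction t rule: tensor_induct)
    case one
    show ?case using words[of "[]"] by simp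
  next
    case (gen x t)
    have "z * t \<in> ?W" if "z \<in> sc.span (range G \<union> K)" for z
      using that
    proof (induction z rule: sc.span_induct_alt)
      case base
      show ?case using sc.subspace_0[OF W] by simp
    next
      case (step c b y)
      have "(sc c b + y) * t = sc c (b * t) + y * t"
        by (simp add: distrib_right sc_mult_left)
      then show ?case
        using sc.subspace_add[OF W sc.subspace_scale[OF W letter[OF step(1) gen]] step(2)] by simp
    qed
    then show ?case using generators by blast
  next
    case (add p q)
    then show ?case by (rule sc.subspace_add[OF W])
  next
    case (scale c p)
    then show ?case by (rule sc.subspace_scale[OF W])
  qed
  then show ?thesis by simp
qed

end

section \<open>Triangular linear maps, and the bijectivity criterion for orbit maps\<close>

text \<open>At a key \<open>M\<close> of \<open>p\<close> with maximal \<open>\<kappa>\<close>, no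
  correction term \<open>q N\<close> contributes, since its keys lie strictly below some
  \<open>\<kappa> N\<close> that is at most \<open>\<kappa> M\<close>. The coefficient of
  \<open>g p\<close> at \<open>M\<close> is thus \<open>u M\<close> times that of \<open>p\<close>.
  Ties in \<open>\<kappa>\<close> do no harm.\<close>

lemma triangular_inj:
  fixes \<kappa> :: "'a \<Rightarrow> nat"
  assumes g: "lin g" and u: "\<And>N. u N \<noteq> 0"
    and tri: "\<And>N. g (Poly_Mapping.single N 1) = sc (u N) (Poly_Mapping.single N 1) + q N"
    and low: "\<And>N M. M \<in> keys (q N) \<Longrightarrow> \<kappa> M < \<kappa> N"
    and "g p = 0"
  shows "p = 0"
proof (rule ccontr)
  assume "p \<noteq> 0"
  then have "keys p \<noteq> {}" by simp
  then obtain M where M: "M \<in> keys p" "\<And>N. N \<in> keys p \<Longrightarrow> \<kappa> N \<le> \<kappa> M"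
    using Max_in[of "\<kappa> ` keys p"] Max_ge[of "\<kappa> ` keys p"] by fastforce
  have "g p = (\<Sum>N\<in>keys p. sc (lookup p N) (g (Poly_Mapping.single N 1)))"
    by (subst poly_mapping_expand[of "keys p" p]) (simp_all add: lin_sum[OF g] lin_sc[OF g])
  then have "0 = (\<Sum>N\<in>keys p. lookup p N * lookup (g (Poly_Mapping.single N 1)) M)"
    using assms(5) by (metis (no_types, lifting) lookup_sc lookup_sum lookup_zero sum.cong)
  also have "\<dots> = (\<Sum>N\<in>keys p. if N = M then lookup p M * u M else 0)"
  proof (rule sum.cong[OF refl])
    fix N assume "N \<in> keys p"
    then have "M \<notin> keys (q N)" using low[of M N] M(2)[of N] by auto
    then have "lookup (q N) M = 0" by (simp add: in_keys_iff)
    then show "lookup p N * lookup (g (Poly_Mapping.single N 1)) M = (if N = M then lookup p M * u M else 0)"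
      by (simp add: tri lookups lookup_single when_def)
  qed
  also have "\<dots> = lookup p M * u M"
    using M(1) by simp
  finally show False using M(1) u by (simp add: in_keys_iff)
qed

text \<open>Well-founded induction on \<open>\<kappa>\<close>: the correction \<open>q N\<close> is
  already in the range, so the triangular equation can be solved for the basis vector
  \<open>N\<close>.\<close>

lemma triangular_surj:
  fixes \<kappa> :: "'a \<Rightarrow> nat"
  assumes g: "lin g" and u: "\<And>N. u N \<noteq> 0"
    and tri: "\<And>N. g (Poly_Mapping.single N 1) = sc (u N) (Poly_Mapping.single N 1) + q N"
    and low: "\<And>N M. M \<in> keys (q N) \<Longrightarrow> \<kappa> M < \<kappa> N"
  shows "p \<in> range g"
proof -
  have add: "s + t \<in> range g" if "s \<in> range g" "t \<in> range g" for s t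
    using that by (auto simp flip: lin_add[OF g])
  have scale: "sc c t \<in> range g" if "t \<in> range g" for c t
    using that by (auto simp flip: lin_sc[OF g])
  have zero: "0 \<in> range g" using lin_zero[OF g] by (metis rangeI)
  have sums: "(\<Sum>k\<in>A. f k) \<in> range g" if "\<And>k. k \<in> A \<Longrightarrow> f k \<in> range g" for A f
    using that by (induction A rule: infinite_finite_induct) (auto intro: add zero)
  have "Poly_Mapping.single N 1 \<in> range g" for N
  proof (induction "\<kappa> N" arbitrary: N rule: less_induct)
    case less
    have "(\<Sum>M\<in>keys (q N). sc (lookup (q N) M) (Poly_Mapping.single M 1)) \<in> range g"
      by (intro sums scale less low)
    then have "q N \<in> range g"
      using poly_mapping_expand[of "keys (q N)" "q N"] by simp
    then have "sc (inverse (u N)) (g (Poly_Mapping.single N 1) + sc (-1) (q N)) \<in> range g"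
      by (intro scale add) auto
    moreover have "sc (inverse (u N)) (g (Poly_Mapping.single N 1) + sc (-1) (q N)) = Poly_Mapping.single N 1"
      by (rule poly_mapping_eqI) (simp add: tri lookups u field_simps)
    ultimately show ?case by simp
  qed
  then show ?thesis
    by (induction p rule: poly_mapping_lin_induct) (auto intro: add scale)
qed

definition pmod :: "(complex, 'b \<Rightarrow>\<^sub>0 complex) module" where
  "pmod = \<lparr>carrier = UNIV, monoid.mult = undefined, one = undefined, zero = 0, add = (+), module.smult = sc\<rparr>"

lemma pmod_simps [simp]:
  "carrier pmod = UNIV" "zero pmod = 0" "add pmod = (+)" "module.smult pmod = sc"
  by (simp_all add: pmod_def)

lemma abelian_group_pmod: "abelian_group pmod"
proof (rule abelian_groupI, goal_cases)
  case (6 x)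
  show ?case by (rule bexI[of _ "- x"]) auto
qed (auto simp: add_ac)

text \<open>The map sending the coset of \<open>t\<close> to \<open>t\<close> applied to
  \<open>v\<close>. It uses an arbitrary representative, and does not depend on it as soon as
  \<open>J\<close> annihilates \<open>v\<close>.\<close>

definition orbit_map :: "('g \<Rightarrow> ('b \<Rightarrow>\<^sub>0 complex) \<Rightarrow> ('b \<Rightarrow>\<^sub>0 complex)) \<Rightarrow> ('b \<Rightarrow>\<^sub>0 complex) \<Rightarrow> 'g tensor set \<Rightarrow> 'b \<Rightarrow>\<^sub>0 complex"
  where "orbit_map \<rho> v A = act \<rho> (SOME x. x \<in> A) v"

lemma orbit_map_coset:
  assumes "left_ideal J" "\<And>t. t \<in> J \<Longrightarrow> act \<rho> t v = 0"
  shows "orbit_map \<rho> v (x +o J) = act \<rho> x v"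
proof -
  have "x \<in> x +o J" using left_idealD(1)[OF assms(1)] by (simp add: coset_iff)
  then have "(SOME y. y \<in> x +o J) - x \<in> J"
    by (metis coset_iff someI)
  from assms(2)[OF this] show ?thesis by (simp add: orbit_map_def act_diff)
qed

text \<open>The composite of the coefficients of ordered monomials with the orbit map is triangular,
  hence bijective. With the spanning theorem this forces the annihilator of \<open>v\<close> to be
  exactly \<open>J\<close>.\<close>

lemma (in straightening) quotient_iso:
  fixes \<kappa> :: "'v multiset \<Rightarrow> nat"
  assumes lin: "\<And>x. lin (\<rho> x)"
    and ann: "\<And>t. t \<in> J \<Longrightarrow> act \<rho> t v = 0"
    and u: "\<And>N. u N \<noteq> 0"
    and tri: "\<And>N. act \<rho> (ordered N) v = sc (u N) (Poly_Mapping.single N 1) + q N"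
    and low: "\<And>N M. M \<in> keys (q N) \<Longrightarrow> \<kappa> M < \<kappa> N"
  shows "linear_iso (quotient_space J) pmod (orbit_map \<rho> v)"
proof -
  let ?g = "\<lambda>c. act \<rho> (ext ordered c) v"
  have g: "lin ?g" by (intro linI) (simp_all add: lin_add[OF lin_ext] lin_sc[OF lin_ext] act_add act_sc)
  have g_single: "?g (Poly_Mapping.single N 1) = sc (u N) (Poly_Mapping.single N 1) + q N" for N
    by (simp add: tri)
  have inj: "c = 0" if "?g c = 0" for c
    using triangular_inj[OF g u g_single low that] .
  have surj: "p \<in> range ?g" for p
    using triangular_surj[OF g u g_single low] .
  have span: "s \<in> range (ext ordered)" if "s \<in> sc.span (range ordered)" for s
    using that
  proof (induction s rule: sc.span_induct_alt)
    case base
    show ?case using lin_zero[OF lin_ext] by (metis rangeI)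
  next
    case (step c x y)
    then obtain N d where "x = ext ordered (Poly_Mapping.single N 1)" "y = ext ordered d" by auto
    then have "sc c x + y = ext ordered (sc c (Poly_Mapping.single N 1) + d)"
      by (simp only: lin_add[OF lin_ext] lin_sc[OF lin_ext])
    then show ?case by simp
  qed
  \<comment> \<open>Modulo \<open>J\<close>, \<open>t\<close> is a combination of ordered monomials
    that still kills \<open>v\<close>; by \<open>inj\<close> its coefficients vanish.\<close>
  have ker: "t \<in> J" if "act \<rho> t v = 0" for t
  proof -
    obtain j where j: "j \<in> J" "t - j \<in> sc.span (range ordered)"
      using ordered_spans by blast
    obtain c where c: "t - j = ext ordered c" using span[OF j(2)] by auto
    then have "?g c = 0" using that ann[OF j(1)] by (simp flip: c add: act_diff)
    then have "c = 0" by (rule inj)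
    then show ?thesis using c j(1) by (simp add: lin_zero[OF lin_ext])
  qed
  note om = orbit_map_coset[where \<rho> = \<rho> and v = v, OF J ann]
  have "inj_on (orbit_map \<rho> v) (range (\<lambda>x. x +o J))"
  proof (rule inj_onI, clarsimp simp: om)
    fix x y assume "act \<rho> x v = act \<rho> y v"
    then show "x +o J = y +o J" by (simp add: coset_eq_iff[OF J] ker act_diff)
  qed
  moreover have "orbit_map \<rho> v ` range (\<lambda>x. x +o J) = UNIV"
  proof safe
    fix p
    obtain c where "p = ?g c" using surj by blast
    then show "p \<in> orbit_map \<rho> v ` range (\<lambda>x. x +o J)"
      by (intro image_eqI[of _ _ "ext ordered c +o J"]) (auto simp: om)
  qed auto
  ultimately show ?thesis
    by (auto simp: linear_iso_def bij_betw_def quotient_space_simps coset_add[OF J]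
      coset_act_coset[OF J] om act_add scal_mult act_sc)
qed

lemma orbit_map_coset_act:
  assumes "left_ideal J" "\<And>t. t \<in> J \<Longrightarrow> act \<rho> t v = 0" "\<And>x. lin (\<rho> x)"
    and "A \<in> carrier (quotient_space J)"
  shows "orbit_map \<rho> v (coset_act J t A) = act \<rho> t (orbit_map \<rho> v A)"
  using assms(4)
  by (auto simp: quotient_space_simps coset_act_coset[OF assms(1)] orbit_map_coset[where \<rho> = \<rho> and v = v, OF assms(1,2)] act_mult[OF assms(3)])

text \<open>Letters may be combinations of generators, such as \<alpha> + \<beta>, so the bracket
  relation is extended bilinearly while its free right factor is kept.\<close>

lemma gen_bracket_span:
  assumes J: "left_ideal J" and S: "sc.subspace S"
    and gens: "\<And>x y. \<exists>z\<in>S. \<forall>t. (gen x * gen y - gen y * gen x - z) * t \<in> J"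
    and "a \<in> sc.span (range gen)" "b \<in> sc.span (range gen)"
  shows "\<exists>z\<in>S. \<forall>t. (a * b - b * a - z) * t \<in> J"
proof -
  have step: "\<exists>z\<in>S. \<forall>t. (gen x * b - b * gen x - z) * t \<in> J" for x
    using assms(5)
  proof (induction b rule: sc.span_induct_alt)
    case base
    show ?case using sc.subspace_0[OF S] left_idealD(1)[OF J] by (intro bexI[of _ 0]) auto
  next
    case (step c b y)
    obtain z w where z: "z \<in> S" "\<And>t. (gen x * b - b * gen x - z) * t \<in> J"
      and w: "w \<in> S" "\<And>t. (gen x * y - y * gen x - w) * t \<in> J"
      using step gens by blast
    have "(gen x * (sc c b + y) - (sc c b + y) * gen x - (sc c z + w)) * t
        = sc c ((gen x * b - b * gen x - z) * t) + (gen x * y - y * gen x - w) * t" for t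
      by (simp add: algebra_simps sc_mult_left sc_mult_right sc.scale_right_distrib sc.scale_right_diff_distrib)
    then show ?case
      using z w left_idealD(2,6)[OF J] sc.subspace_add[OF S] sc.subspace_scale[OF S]
      by (intro bexI[of _ "sc c z + w"]) auto
  qed
  show ?thesis
    using assms(4)
  proof (induction a rule: sc.span_induct_alt)
    case base
    show ?case using sc.subspace_0[OF S] left_idealD(1)[OF J] by (intro bexI[of _ 0]) auto
  next
    case (step c a y)
    obtain z w where z: "z \<in> S" "\<And>t. (a * b - b * a - z) * t \<in> J"
      and w: "w \<in> S" "\<And>t. (y * b - b * y - w) * t \<in> J"
      using step \<open>\<And>x. \<exists>z\<in>S. \<forall>t. (gen x * b - b * gen x - z) * t \<in> J\<close> by blast
    have "((sc c a + y) * b - b * (sc c a + y) - (sc c z + w)) * t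
        = sc c ((a * b - b * a - z) * t) + (y * b - b * y - w) * t" for t
      by (simp add: algebra_simps sc_mult_left sc_mult_right sc.scale_right_distrib sc.scale_right_diff_distrib)
    then show ?case
      using z w left_idealD(2,6)[OF J] sc.subspace_add[OF S] sc.subspace_scale[OF S]
      by (intro bexI[of _ "sc c z + w"]) auto
  qed
qed

definition word_of :: "'v multiset \<Rightarrow> 'v list" where
  "word_of N = (SOME l. mset l = N)"

lemma mset_word_of [simp]: "mset (word_of N) = N"
  unfolding word_of_def by (rule someI_ex) (rule ex_mset)

lemma straightening_induced_ideal:
  assumes G: "\<And>v. G v \<in> sc.span (range gen)"
    and br: "\<And>x y. br x y \<in> sc.span (range gen)"
    and gens: "\<And>x. gen x \<in> sc.span (range G \<union> gen ` Q)"
  shows "straightening (induced_ideal br Q \<chi>) G (gen ` Q) word_of"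
proof (rule straightening.intro)
  have sub: "range G \<union> gen ` Q \<subseteq> sc.span (range gen)"
    using G by (auto intro: sc.span_base)
  have "sc.span (range gen) \<subseteq> sc.span (range G \<union> gen ` Q)"
    using gens by (intro sc.span_minimal) auto
  then have "br x y \<in> sc.span (range G \<union> gen ` Q)" for x y
    using br[of x y] by (rule subsetD)
  then have *: "\<exists>z\<in>sc.span (range G \<union> gen ` Q). \<forall>t. (gen x * gen y - gen y * gen x - z) * t \<in> induced_ideal br Q \<chi>" for x y
    by (intro bexI[of _ "br x y"] allI induced_ideal_bracket)
  show "\<exists>z\<in>sc.span (range G \<union> gen ` Q). \<forall>t. (x * y - y * x - z) * t \<in> induced_ideal br Q \<chi>"
    if "x \<in> range G \<union> gen ` Q" "y \<in> range G \<union> gen ` Q" for x y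
    using that sub by (intro gen_bracket_span[OF left_ideal_induced_ideal sc.subspace_span *]) auto
  show "\<exists>c. k - scal c \<in> induced_ideal br Q \<chi>" if "k \<in> gen ` Q" for k
    using that induced_ideal_character[where br = br and \<chi> = \<chi>] by auto
qed (rule left_ideal_induced_ideal gens mset_word_of)+

section \<open>The polynomial model of the Fock space\<close>

type_synonym fpoly = "(hbasis \<times> nat) multiset \<Rightarrow>\<^sub>0 complex"

text \<open>Multiplication by the variable \<open>v\<close>; \<open>dd\<close> below is the partial
  derivative, the factor \<open>count M v + 1\<close> being the exponent of \<open>v\<close> in
  \<open>add_mset v M\<close>. Both are given by coefficients, so that identities can be verified
  coefficientwise.\<close>

definition mul :: "'v \<Rightarrow> ('v multiset \<Rightarrow>\<^sub>0 complex) \<Rightarrow> 'v multiset \<Rightarrow>\<^sub>0 complex" where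
  "mul v p = Abs_poly_mapping (\<lambda>M. if v \<in># M then lookup p (M - {#v#}) else 0)"

definition dd :: "'v \<Rightarrow> ('v multiset \<Rightarrow>\<^sub>0 complex) \<Rightarrow> 'v multiset \<Rightarrow>\<^sub>0 complex" where
  "dd v p = Abs_poly_mapping (\<lambda>M. of_nat (count M v + 1) * lookup p (add_mset v M))"

lemma lookup_mul: "lookup (mul v p) M = (if v \<in># M then lookup p (M - {#v#}) else 0)"
proof -
  have "{M. (if v \<in># M then lookup p (M - {#v#}) else 0) \<noteq> 0} \<subseteq> add_mset v ` keys p"
  proof
    fix M assume "M \<in> {M. (if v \<in># M then lookup p (M - {#v#}) else 0) \<noteq> 0}"
    then have "v \<in># M" "M - {#v#} \<in> keys p" by (auto simp: in_keys_iff split: if_splits)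
    then show "M \<in> add_mset v ` keys p" by (metis image_iff insert_DiffM)
  qed
  then have "finite {M. (if v \<in># M then lookup p (M - {#v#}) else 0) \<noteq> 0}"
    by (rule finite_subset) simp
  then show ?thesis
    unfolding mul_def by (subst lookup_Abs_poly_mapping) simp_all
qed

lemma lookup_dd: "lookup (dd v p) M = of_nat (count M v + 1) * lookup p (add_mset v M)"
proof -
  have "{M. of_nat (count M v + 1) * lookup p (add_mset v M) \<noteq> 0} \<subseteq> add_mset v -` keys p"
    by (auto simp: in_keys_iff)
  moreover have "finite (add_mset v -` keys p)"
    by (intro finite_vimageI) (auto simp: inj_def)
  ultimately have "finite {M. of_nat (count M v + 1) * lookup p (add_mset v M) \<noteq> 0}"
    by (rule finite_subset)
  then show ?thesis
    unfolding dd_def by (subst lookup_Abs_poly_mapping) simp_all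
qed

lemma lin_mul: "lin (mul v)" and lin_dd: "lin (dd v)"
  by (auto intro!: linI poly_mapping_eqI simp: lookups lookup_mul lookup_dd algebra_simps)

lemma mul_single: "mul v (Poly_Mapping.single M c) = Poly_Mapping.single (add_mset v M) c"
proof (rule poly_mapping_eqI)
  fix N
  have "v \<in># N \<and> M = N - {#v#} \<longleftrightarrow> add_mset v M = N"
    by (metis add_mset_remove_trivial insert_DiffM union_single_eq_member)
  then show "lookup (mul v (Poly_Mapping.single M c)) N = lookup (Poly_Mapping.single (add_mset v M) c) N"
    by (auto simp: lookup_mul lookup_single when_def)
qed

lemma mul_commute: "mul v (mul w p) = mul w (mul v p)"
proof (rule poly_mapping_eqI, cases "v = w")
  fix M assume "v \<noteq> w"
  show "lookup (mul v (mul w p)) M = lookup (mul w (mul v p)) M"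
  proof (cases "v \<in># M \<and> w \<in># M")
    case True
    then obtain N where "M = add_mset v (add_mset w N)"
      using \<open>v \<noteq> w\<close> by (metis insert_DiffM insert_noteq_member)
    then show ?thesis using \<open>v \<noteq> w\<close> by (simp add: lookup_mul add_mset_commute)
  next
    case False
    then show ?thesis using \<open>v \<noteq> w\<close> by (auto simp: lookup_mul dest: in_diffD)
  qed
qed simp

lemma dd_commute: "dd v (dd w p) = dd w (dd v p)"
  by (rule poly_mapping_eqI) (auto simp: lookup_dd add_mset_commute)

text \<open>The Weyl algebra relation, from which all Heisenberg commutators below are
  derived.\<close>

lemma dd_mul: "dd v (mul w p) = mul w (dd v p) + (if v = w then p else 0)"
proof (rule poly_mapping_eqI)
  fix M
  show "lookup (dd v (mul w p)) M = lookup (mul w (dd v p) + (if v = w then p else 0)) M"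
  proof (cases "v = w")
    case True
    show ?thesis
    proof (cases "w \<in># M")
      case True
      then obtain N where "M = add_mset w N" by (metis insert_DiffM)
      then show ?thesis using \<open>v = w\<close> by (simp add: lookup_dd lookup_mul lookup_add algebra_simps)
    next
      case False
      moreover from False have "count M w = 0" by (simp add: not_in_iff)
      ultimately show ?thesis using \<open>v = w\<close> by (simp add: lookup_dd lookup_mul lookup_add)
    qed
  next
    case False
    show ?thesis
    proof (cases "w \<in># M")
      case True
      then obtain N where "M = add_mset w N" by (metis insert_DiffM)
      then show ?thesis using \<open>v \<noteq> w\<close> by (simp add: lookup_dd lookup_mul lookup_add)
    next
      case F: False
      then show ?thesis using \<open>v \<noteq> w\<close> by (simp add: lookup_dd lookup_mul lookup_add)
    qed
  qed
qed

definition vac :: "'v multiset \<Rightarrow>\<^sub>0 complex" where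
  "vac = Poly_Mapping.single {#} 1"

lemma dd_vac: "dd v vac = 0"
  by (rule poly_mapping_eqI) (simp add: lookup_dd vac_def lookup_one)

lemma foldr_mul_vac: "foldr mul l vac = Poly_Mapping.single (mset l) 1"
  by (induction l) (simp_all add: vac_def mul_single)

lemma mul_induct [case_names vac mul add scale]:
  assumes "Q vac" "\<And>v p. Q p \<Longrightarrow> Q (mul v p)" "\<And>p q. Q p \<Longrightarrow> Q q \<Longrightarrow> Q (p + q)"
    "\<And>c p. Q p \<Longrightarrow> Q (sc c p)"
  shows "Q p"
proof (induction p rule: poly_mapping_lin_induct)
  case (single M)
  show ?case
  proof (induction M)
    case empty
    show ?case using assms(1) by (simp add: vac_def)
  next
    case (add v M)
    then show ?case using assms(2)[OF add] by (simp add: mul_single)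
  qed
qed (use assms in auto)

text \<open>In characteristic 0 the derivative by any variable of a nonconstant monomial recovers
  its coefficient up to a nonzero integer.\<close>

lemma dd_zero_imp_scalar:
  assumes "\<And>v. dd v p = 0"
  shows "p = sc (lookup p {#}) vac"
proof (rule poly_mapping_eqI)
  fix M
  show "lookup p M = lookup (sc (lookup p {#}) vac) M"
  proof (cases M)
    case (add v N)
    have "lookup (dd v p) N = 0" using assms by simp
    moreover have "of_nat (count N v + 1) \<noteq> (0 :: complex)"
      by (metis Suc_eq_plus1 of_nat_neq_0)
    ultimately have "lookup p M = 0" by (simp only: lookup_dd add mult_eq_0_iff) simp
    then show ?thesis using add by (simp add: vac_def lookup_one)
  qed (simp add: vac_def)
qed

locale free_field =
  fixes r s cL cLI :: complex
  assumes cLI: "cLI \<noteq> 0"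
begin

text \<open>
  The variables \<open>(Alpha, i)\<close> and \<open>(Beta, i)\<close> stand for the creation operators
  \<open>(\<alpha> + \<beta>)(-i-1)\<close> and \<open>(\<alpha> - \<beta>)(-i-1)\<close>; both combinations are isotropic.
\<close>

fun dual :: "hbasis \<Rightarrow> hbasis" where
  "dual Alpha = Beta" | "dual Beta = Alpha"

text \<open>The pairings of \<alpha> + \<beta> and \<alpha> - \<beta> with r \<alpha> + s \<beta>;
  the signs reflect that \<beta> has norm -1.\<close>

fun zw :: "hbasis \<Rightarrow> complex" where
  "zw Alpha = r - s" | "zw Beta = r + s"

text \<open>The modes of \<alpha> + \<beta> and \<alpha> - \<beta>. An annihilation mode
  differentiates by the variable of the other combination, because each is isotropic; the 2 is their
  mutual pairing. The shifts by 1 occur because variable \<open>i\<close> belongs to mode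
  \<open>-i-1\<close>.\<close>

definition zop :: "hbasis \<Rightarrow> int \<Rightarrow> fpoly \<Rightarrow> fpoly" where
  "zop d n p = (if n < 0 then mul (d, nat (- n - 1)) p else if n = 0 then sc (zw d) p
     else sc (2 * of_int n) (dd (dual d, nat (n - 1)) p))"

lemma lin_zop: "lin (zop d n)"
  by (rule linI) (auto simp: zop_def lin_simps[OF lin_mul] lin_simps[OF lin_dd] sc.scale_right_distrib mult.commute)

lemma mul_zop: "mul (d, i) p = zop d (- int i - 1) p"
  by (simp add: zop_def)

lemma dual_eq: "dual d = e \<longleftrightarrow> d \<noteq> e"
  by (cases d; cases e) auto

lemma zop_commute:
  "zop d m (zop e n p) = zop e n (zop d m p) + sc (if m + n = 0 \<and> d \<noteq> e then 2 * of_int m else 0) p"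
proof -
  consider "m < 0" "n < 0" | "m < 0" "n > 0" | "m > 0" "n < 0" | "m > 0" "n > 0" | "m = 0" | "n = 0"
    by linarith
  then show ?thesis
  proof cases
    case 1
    then show ?thesis by (simp add: zop_def mul_commute[of "(d, nat (- m - 1))"])
  next
    case 2
    then have "dual e = d \<and> nat (n - 1) = nat (- m - 1) \<longleftrightarrow> m + n = 0 \<and> d \<noteq> e"
      by (auto simp: dual_eq)
    then have "dd (dual e, nat (n - 1)) (mul (d, nat (- m - 1)) p)
        = mul (d, nat (- m - 1)) (dd (dual e, nat (n - 1)) p) + (if m + n = 0 \<and> d \<noteq> e then p else 0)"
      by (simp add: dd_mul)
    moreover have "of_int n = - (of_int m :: complex)" if "m + n = 0"
      using that by (simp add: add_eq_0_iff)
    ultimately show ?thesis using 2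
      by (auto simp: zop_def lin_simps[OF lin_mul] lookups algebra_simps intro!: poly_mapping_eqI)
  next
    case 3
    then have "dual d = e \<and> nat (m - 1) = nat (- n - 1) \<longleftrightarrow> m + n = 0 \<and> d \<noteq> e"
      by (auto simp: dual_eq)
    then have "dd (dual d, nat (m - 1)) (mul (e, nat (- n - 1)) p)
        = mul (e, nat (- n - 1)) (dd (dual d, nat (m - 1)) p) + (if m + n = 0 \<and> d \<noteq> e then p else 0)"
      by (simp add: dd_mul)
    then show ?thesis using 3
      by (auto simp: zop_def lin_simps[OF lin_mul] lookups algebra_simps intro!: poly_mapping_eqI)
  next
    case 4
    then show ?thesis by (simp add: zop_def lin_simps[OF lin_dd] dd_commute[of "(dual d, nat (m - 1))"] mult.commute)
  next
    case 5
    then show ?thesis by (simp add: zop_def[of d] lin_simps[OF lin_zop])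
  next
    case 6
    then show ?thesis by (simp add: zop_def[of e] lin_simps[OF lin_zop])
  qed
qed

lemma zop_vac: "n > 0 \<Longrightarrow> zop d n vac = 0" "zop d 0 p = sc (zw d) p"
  by (auto simp: zop_def dd_vac)

fun hop :: "hbasis \<Rightarrow> int \<Rightarrow> fpoly \<Rightarrow> fpoly" where
  "hop Alpha n p = sc (1/2) (zop Alpha n p + zop Beta n p)"
| "hop Beta n p = sc (1/2) (zop Alpha n p - zop Beta n p)"

lemma zop_hop: "zop Alpha n p = hop Alpha n p + hop Beta n p" "zop Beta n p = hop Alpha n p - hop Beta n p"
  by (auto intro!: poly_mapping_eqI simp: lookups field_simps)

lemma lin_hop: "lin (hop d n)"
  by (rule linI; cases d) (auto intro!: poly_mapping_eqI simp: lin_simps[OF lin_zop] lookups algebra_simps)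

fun hw :: "hbasis \<Rightarrow> complex" where
  "hw Alpha = r" | "hw Beta = - s"

lemma hop_vac: "n > 0 \<Longrightarrow> hop d n vac = 0"
  by (cases d) (simp_all add: zop_vac)

lemma hop_zero: "hop d 0 p = sc (hw d) p"
  by (cases d) (auto intro!: poly_mapping_eqI simp: zop_vac lookups field_simps)

definition cc :: "hbasis \<Rightarrow> int \<Rightarrow> hbasis \<Rightarrow> int \<Rightarrow> complex" where
  "cc d m e n = (if m + n = 0 then of_int m * hform d e else 0)"

lemma hop_commute: "hop d m (hop e n p) = hop e n (hop d m p) + sc (cc d m e n) p"
proof (rule poly_mapping_eqI)
  fix k
  show "lookup (hop d m (hop e n p)) k = lookup (hop e n (hop d m p) + sc (cc d m e n) p) k"
    using zop_commute[of Alpha m Alpha n p] zop_commute[of Alpha m Beta n p]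
      zop_commute[of Beta m Alpha n p] zop_commute[of Beta m Beta n p]
    by (cases "m + n = 0"; cases d; cases e) (simp_all add: cc_def lookups lin_simps[OF lin_zop] field_simps)
qed

fun fock_op :: "haff \<Rightarrow> fpoly \<Rightarrow> fpoly" where
  "fock_op (Mode d n) p = hop d n p"
| "fock_op Level p = p"

lemma lin_fock_op: "lin (fock_op x)"
  using lin_hop by (cases x) (auto simp: lin_def)

lemma fock_op_bracket: "fock_op x (fock_op y p) - fock_op y (fock_op x p) = act fock_op (haff_bracket x y) p"
proof (cases x; cases y)
  fix d e m n assume "x = Mode d m" "y = Mode e n"
  then show ?thesis
    by (simp add: hop_commute[of d m e n p] act_mult[OF lin_fock_op] cc_def add_eq_0_iff2 del: hop.simps)
qed (simp_all add: act_zero)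

lemma fock_ideal_annihilates:
  "t \<in> fock_ideal r s \<Longrightarrow> act fock_op t vac = 0"
  unfolding fock_ideal_def
proof (rule induced_ideal_annihilates[OF lin_fock_op fock_op_bracket])
  show "fock_op x vac = sc (haff_weight r s x) vac" if "x \<in> {x. haff_nonneg x}" for x
  proof (cases x)
    case (Mode d n)
    then have "n > 0 \<or> n = 0" using that by auto
    moreover have "hw d = r * hform d Alpha + s * hform d Beta" by (cases d) auto
    ultimately show ?thesis using Mode by (auto simp: hop_vac hop_zero simp del: hop.simps)
  qed auto
qed auto

text \<open>The letters are chosen so that each acts as multiplication by a single variable.\<close>

fun fock_letter :: "hbasis \<times> nat \<Rightarrow> haff tensor" where
  "fock_letter (Alpha, i) = gen (Mode Alpha (- int i - 1)) + gen (Mode Beta (- int i - 1))"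
| "fock_letter (Beta, i) = gen (Mode Alpha (- int i - 1)) - gen (Mode Beta (- int i - 1))"

lemma straightening_fock: "straightening (fock_ideal r s) fock_letter (gen ` {x. haff_nonneg x}) word_of"
  unfolding fock_ideal_def
proof (rule straightening_induced_ideal)
  show "fock_letter v \<in> sc.span (range gen)" for v
    by (cases v rule: fock_letter.cases) (auto intro!: sc.span_add sc.span_diff intro: sc.span_base)
  show "haff_bracket x y \<in> sc.span (range gen)" for x y
    by (cases "(x, y)" rule: haff_bracket.cases)
       (auto simp: scal_mult intro!: sc.span_neg sc.span_scale sc.span_zero intro: sc.span_base)
  show "gen x \<in> sc.span (range fock_letter \<union> gen ` {x. haff_nonneg x})" for x
  proof (cases "haff_nonneg x")
    case True
    then show ?thesis by (auto intro: sc.span_base)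
  next
    case False
    then obtain d n where x: "x = Mode d n" "n < 0" by (cases x) auto
    define i where "i = nat (- n - 1)"
    have n: "n = - int i - 1" using x by (simp add: i_def)
    have "sc (1/2) (fock_letter (Alpha, i) + fock_letter (Beta, i)) \<in> sc.span (range fock_letter \<union> gen ` {x. haff_nonneg x})"
      "sc (1/2) (fock_letter (Alpha, i) - fock_letter (Beta, i)) \<in> sc.span (range fock_letter \<union> gen ` {x. haff_nonneg x})"
      by (intro sc.span_scale sc.span_add sc.span_diff sc.span_base UnI1 rangeI)+
    moreover have "sc (1/2) (fock_letter (Alpha, i) + fock_letter (Beta, i)) = gen (Mode Alpha n)"
      "sc (1/2) (fock_letter (Alpha, i) - fock_letter (Beta, i)) = gen (Mode Beta n)"
      by (auto intro!: poly_mapping_eqI simp: lookups n)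
    ultimately show ?thesis using x by (cases d) auto
  qed
qed

lemma act_fock_letter: "act fock_op (fock_letter v) p = mul v p"
  by (cases v rule: fock_letter.cases) (auto simp: act_add act_diff mul_zop zop_hop simp del: hop.simps)

abbreviation fock_map :: "haff tensor set \<Rightarrow> fpoly" where
  "fock_map \<equiv> orbit_map fock_op vac"

text \<open>Ordered words are sent to monomials exactly, so the triangular criterion applies with
  unit coefficients and zero corrections.\<close>

lemma fock_iso: "linear_iso (fock r s) pmod fock_map"
proof -
  interpret straightening "fock_ideal r s" fock_letter "gen ` {x. haff_nonneg x}" word_of
    by (rule straightening_fock)
  have "act fock_op (prod_list (map fock_letter l)) p = foldr mul l p" for l p
    by (induction l) (simp_all add: act_mult[OF lin_fock_op] act_fock_letter)
  then have *: "act fock_op (ordered N) vac = sc 1 (Poly_Mapping.single N 1) + 0" for N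
    by (simp add: ordered_def foldr_mul_vac)
  show ?thesis
    unfolding fock_def
    by (rule quotient_iso[OF lin_fock_op fock_ideal_annihilates _ *]) auto
qed

lemma fock_map_heis_field:
  "w \<in> carrier (fock r s) \<Longrightarrow> fock_map (heis_field r s d n w) = hop d n (fock_map w)"
  unfolding heis_field_def fock_def
  by (subst orbit_map_coset_act[OF _ fock_ideal_annihilates lin_fock_op])
     (auto simp: fock_ideal_def left_ideal_induced_ideal)

end

section \<open>The Heisenberg-Virasoro operators on the polynomial model\<close>

text \<open>Keeping \<open>c\<close> apart from \<open>k\<close> lets the induction on the range go
  through. For \<open>c = k\<close> the value is \<open>(k^3 - k) / 6\<close>, the source of the
  Virasoro central term.\<close>

lemma sum_int_products:
  "(\<Sum>j\<in>{- int k<..<0}. - of_int j * (c + of_int j))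
     = c * (of_nat k * (of_nat k - 1) / 2) - (of_nat k - 1) * of_nat k * (2 * of_nat k - 1) / (6 :: complex)"
proof (induction k)
  case (Suc k)
  show ?case
  proof (cases "k = 0")
    case False
    then have "{- int (Suc k)<..<0} = insert (- int k) {- int k<..<0}" by auto
    then show ?thesis using Suc by (simp add: field_simps)
  next
    case True
    then have "{- int (Suc k)<..<0} = {}" by auto
    then show ?thesis using True by simp
  qed
qed simp

context free_field
begin

declare hop.simps [simp del]

abbreviation "la \<equiv> lam cL cLI"
abbreviation "mb \<equiv> mu cL cLI"
abbreviation "h0 \<equiv> Delta cL cLI r s"

lemma la_mb: "la - mb = cLI" "la + mb = (2 - cL) / (12 * cLI)" "12 * (la^2 - mb^2) = 2 - cL"
proof -
  show 1: "la - mb = cLI" and 2: "la + mb = (2 - cL) / (12 * cLI)"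
    using cLI by (simp_all add: lam_def mu_def field_simps)
  have "la^2 - mb^2 = (la + mb) * (la - mb)" by (simp add: power2_eq_square algebra_simps)
  also have "\<dots> = (2 - cL) / 12" unfolding 1 2 using cLI by simp
  finally have e: "la^2 - mb^2 = (2 - cL) / 12" .
  show "12 * (la^2 - mb^2) = 2 - cL" unfolding e by simp
qed

lemma zop_local: "\<exists>N. \<forall>n\<ge>N. \<forall>d. zop d n p = 0"
proof (induction p rule: mul_induct)
  case vac
  show ?case by (rule exI[of _ 1]) (auto simp: zop_vac)
next
  case (mul v p)
  then obtain N where N: "\<And>n d. n \<ge> N \<Longrightarrow> zop d n p = 0" by blast
  obtain e i where v: "v = (e, i)" by force
  have "zop d n (mul v p) = 0" if "n \<ge> max N (int i + 2)" for n d
    using that zop_commute[of d n e "- int i - 1" p] by (simp add: v mul_zop N lin_zero[OF lin_zop])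
  then show ?case by blast
next
  case (add p q)
  then obtain N M where "\<And>n d. n \<ge> N \<Longrightarrow> zop d n p = 0" "\<And>n d. n \<ge> M \<Longrightarrow> zop d n q = 0" by blast
  then show ?case by (intro exI[of _ "max N M"]) (simp add: lin_add[OF lin_zop])
next
  case (scale c p)
  then show ?case by (auto simp: lin_sc[OF lin_zop])
qed

lemma hop_local: "\<exists>N. \<forall>n\<ge>N. \<forall>d. hop d n p = 0"
proof -
  obtain N where "\<And>n d. n \<ge> N \<Longrightarrow> zop d n p = 0" using zop_local by blast
  then have "hop d n p = 0" if "n \<ge> N" for n d
    using that by (cases d) (simp_all add: hop.simps)
  then show ?thesis by blast
qed

text \<open>One summand of mode \<open>m\<close> of the normally ordered square. For negative
  \<open>j\<close> the creation mode stands on the left; otherwise mode \<open>j\<close> acts first.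
  On a given polynomial almost all summands vanish.\<close>

definition nord :: "hbasis \<Rightarrow> int \<Rightarrow> int \<Rightarrow> fpoly \<Rightarrow> fpoly" where
  "nord d m j p = (if j < 0 then hop d j (hop d (m - j) p) else hop d (m - j) (hop d j p))"

definition sug :: "hbasis \<Rightarrow> int \<Rightarrow> fpoly \<Rightarrow> fpoly" where
  "sug d m p = Sum_any (\<lambda>j. nord d m j p)"

text \<open>The operator \<open>L(m)\<close> is the mode of the conformal field with index
  \<open>m + 1\<close>; differentiating a Heisenberg field there yields the factor
  \<open>-(m + 1)\<close>.\<close>

definition lop :: "int \<Rightarrow> fpoly \<Rightarrow> fpoly" where
  "lop m p = sc (1/2) (sug Alpha m p) + sc (-1/2) (sug Beta m p)
     + sc la (sc (- of_int (m + 1)) (hop Alpha m p)) + sc mb (sc (- of_int (m + 1)) (hop Beta m p))"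

lemma lin_nord: "lin (nord d m j)"
  by (rule linI) (simp_all add: nord_def lin_simps[OF lin_hop])

lemma nord_finite: "finite {j. nord d m j p \<noteq> 0}"
proof -
  obtain N where N: "\<And>n d. n \<ge> N \<Longrightarrow> hop d n p = 0" using hop_local by blast
  have "{j. nord d m j p \<noteq> 0} \<subseteq> {min (m - N) 0..max N 0}"
  proof
    fix j assume "j \<in> {j. nord d m j p \<noteq> 0}"
    then have "nord d m j p \<noteq> 0" by simp
    then have "(j < 0 \<longrightarrow> \<not> m - j \<ge> N) \<and> (j \<ge> 0 \<longrightarrow> \<not> j \<ge> N)"
      using N by (auto simp: nord_def lin_zero[OF lin_hop])
    then show "j \<in> {min (m - N) 0..max N 0}" by auto
  qed
  then show ?thesis by (rule finite_subset) simp
qed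

lemma sug_sum: "finite S \<Longrightarrow> {j. nord d m j p \<noteq> 0} \<subseteq> S \<Longrightarrow> sug d m p = (\<Sum>j\<in>S. nord d m j p)"
  unfolding sug_def by (rule Sum_any.expand_superset)

lemma lin_sug: "lin (sug d m)"
proof (rule linI)
  fix p q and c :: complex
  define S where "S = {j. nord d m j p \<noteq> 0} \<union> {j. nord d m j q \<noteq> 0}"
  have S: "finite S" "{j. nord d m j p \<noteq> 0} \<subseteq> S" "{j. nord d m j q \<noteq> 0} \<subseteq> S"
    "{j. nord d m j (p + q) \<noteq> 0} \<subseteq> S" "{j. nord d m j (sc c p) \<noteq> 0} \<subseteq> S"
    by (auto simp: S_def nord_finite lin_simps[OF lin_nord])
  show "sug d m (p + q) = sug d m p + sug d m q" "sug d m (sc c p) = sc c (sug d m p)"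
    by (simp_all add: sug_sum[OF S(1,2)] sug_sum[OF S(1,3)] sug_sum[OF S(1,4)] sug_sum[OF S(1,5)]
        lin_simps[OF lin_nord] sum.distrib sc.scale_sum_right)
qed

lemma lin_lop: "lin (lop m)"
  by (rule linI) (auto intro!: poly_mapping_eqI
    simp: lop_def lin_simps[OF lin_sug] lin_simps[OF lin_hop] lookups algebra_simps)

lemma nord_hop:
  "nord d m j (hop e k p) = hop e k (nord d m j p)
     + (sc (cc d j e k) (hop d (m - j) p) + sc (cc d (m - j) e k) (hop d j p))"
  unfolding nord_def hop_commute[of d j e k p] hop_commute[of d "m - j" e k p]
  by (simp add: lin_simps[OF lin_hop] hop_commute[of d j e k "hop d (m - j) p"]
      hop_commute[of d "m - j" e k "hop d j p"] add_ac)

text \<open>Commutators of Heisenberg modes are scalars, so mode \<open>k\<close> of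
  \<open>e\<close> meets only two summands, \<open>j = - k\<close> and \<open>j = m + k\<close>.
  They contribute equally, hence the factor 2; the finite set \<open>S\<close> is enlarged to
  contain both indices.\<close>

lemma sug_hop:
  "sug d m (hop e k p) = hop e k (sug d m p) + sc (- 2 * of_int k * hform d e) (hop d (m + k) p)"
proof -
  define S where "S = {j. nord d m j p \<noteq> 0} \<union> {j. nord d m j (hop e k p) \<noteq> 0} \<union> {- k, m + k}"
  have S: "finite S" "{j. nord d m j p \<noteq> 0} \<subseteq> S" "{j. nord d m j (hop e k p) \<noteq> 0} \<subseteq> S"
    "- k \<in> S" "m + k \<in> S"
    by (auto simp: S_def nord_finite)
  have "(\<Sum>j\<in>S. sc (cc d j e k) (hop d (m - j) p))
      = (\<Sum>j\<in>S. if j = - k then sc (- of_int k * hform d e) (hop d (m + k) p) else 0)"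
    by (rule sum.cong) (auto simp: cc_def)
  then have 1: "(\<Sum>j\<in>S. sc (cc d j e k) (hop d (m - j) p)) = sc (- of_int k * hform d e) (hop d (m + k) p)"
    using S by simp
  have "(\<Sum>j\<in>S. sc (cc d (m - j) e k) (hop d j p))
      = (\<Sum>j\<in>S. if j = m + k then sc (- of_int k * hform d e) (hop d (m + k) p) else 0)"
    by (rule sum.cong) (auto simp: cc_def)
  then have 2: "(\<Sum>j\<in>S. sc (cc d (m - j) e k) (hop d j p)) = sc (- of_int k * hform d e) (hop d (m + k) p)"
    using S by simp
  have "sug d m (hop e k p) = hop e k (sug d m p)
      + ((\<Sum>j\<in>S. sc (cc d j e k) (hop d (m - j) p)) + (\<Sum>j\<in>S. sc (cc d (m - j) e k) (hop d j p)))"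
    by (simp add: sug_sum[OF S(1,3)] sug_sum[OF S(1,2)] nord_hop sum.distrib lin_sum[OF lin_hop])
  then have eq: "sug d m (hop e k p) = hop e k (sug d m p)
      + (sc (- of_int k * hform d e) (hop d (m + k) p) + sc (- of_int k * hform d e) (hop d (m + k) p))"
    unfolding 1 2 .
  show ?thesis
    unfolding eq by (rule poly_mapping_eqI) (simp add: lookups algebra_simps)
qed

text \<open>The background charge: the pairing of the basis vector with \<open>la\<close> \<alpha> +
  \<open>mb\<close> \<beta>.\<close>

definition bg :: "hbasis \<Rightarrow> complex" where
  "bg d = (case d of Alpha \<Rightarrow> la | Beta \<Rightarrow> - mb)"

lemma lop_hop:
  "lop m (hop e k p) = hop e k (lop m p) + sc (- of_int k) (hop e (m + k) p)
     + sc (if m + k = 0 then - (of_int m ^ 2 + of_int m) * bg e else 0) p"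
proof (rule poly_mapping_eqI)
  fix x
  show "lookup (lop m (hop e k p)) x = lookup (hop e k (lop m p) + sc (- of_int k) (hop e (m + k) p)
     + sc (if m + k = 0 then - (of_int m ^ 2 + of_int m) * bg e else 0) p) x"
    unfolding lop_def sug_hop hop_commute[of Alpha m e k p] hop_commute[of Beta m e k p]
    by (cases "m + k = 0"; cases e) (simp_all add: cc_def bg_def lin_simps[OF lin_hop] lookups power2_eq_square algebra_simps)
qed

lemma lop_zop:
  "lop m (zop e k p) = zop e k (lop m p) + sc (- of_int k) (zop e (m + k) p)
     + sc (if m + k = 0 then - (of_int m ^ 2 + of_int m) * (case e of Alpha \<Rightarrow> la - mb | Beta \<Rightarrow> la + mb) else 0) p"
  by (cases e) (auto intro!: poly_mapping_eqI simp: zop_hop lop_hop lin_simps[OF lin_lop] bg_def lookups algebra_simps)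

lemma lop_pos_vac: "m > 0 \<Longrightarrow> lop m vac = 0"
proof -
  assume m: "m > 0"
  have "nord d m j vac = 0" for d j
  proof -
    consider "j < 0" | "j = 0" | "j > 0" by linarith
    then show ?thesis
      using m by cases (auto simp: nord_def hop_vac hop_zero lin_simps[OF lin_hop])
  qed
  then show "lop m vac = 0" using m by (simp add: lop_def sug_def hop_vac)
qed

lemma lop_zero_vac: "lop 0 vac = sc h0 vac"
proof -
  have "nord d 0 j vac = (if j = 0 then sc (hw d ^ 2) vac else 0)" for d j
  proof -
    consider "j < 0" | "j = 0" | "j > 0" by linarith
    then show ?thesis
      by cases (auto simp: nord_def hop_vac hop_zero lin_simps[OF lin_hop] power2_eq_square)
  qed
  then have "sug d 0 vac = sc (hw d ^ 2) vac" for d by (simp add: sug_def)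
  then show ?thesis
    by (auto intro!: poly_mapping_eqI simp: lop_def hop_zero Delta_def lookups power2_eq_square algebra_simps)
qed

lemma lop_neg_vac:
  assumes n: "n < 0"
  shows "lop n vac = sc (r - (of_int n + 1) * la) (hop Alpha n vac) + sc (s - (of_int n + 1) * mb) (hop Beta n vac)
    + (\<Sum>j\<in>{n<..<0}. sc (1/2) (hop Alpha j (hop Alpha (n - j) vac)) + sc (-1/2) (hop Beta j (hop Beta (n - j) vac)))"
proof -
  have zero: "nord d n j vac = 0" if "j \<notin> {n..0}" for d j
    using that n by (auto simp: nord_def hop_vac lin_simps[OF lin_hop])
  have sug: "sug d n vac = sc (2 * hw d) (hop d n vac) + (\<Sum>j\<in>{n<..<0}. hop d j (hop d (n - j) vac))" for d
  proof -
    have "sug d n vac = (\<Sum>j\<in>{n..0}. nord d n j vac)"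
      using zero[of _ d] by (intro sug_sum subsetI) (simp, metis (mono_tags, lifting) mem_Collect_eq)
    \<comment> \<open>The end points \<open>j = n\<close> and \<open>j = 0\<close> both pair mode
      \<open>n\<close> with the zero mode, which yields the coefficient
      \<open>2 * hw d\<close>.\<close>
    also have "{n..0} = insert n (insert 0 {n<..<0})" using n by auto
    also have "(\<Sum>j\<in>\<dots>. nord d n j vac) = nord d n n vac + nord d n 0 vac + (\<Sum>j\<in>{n<..<0}. nord d n j vac)"
      using n by (simp add: add_ac)
    also have "(\<Sum>j\<in>{n<..<0}. nord d n j vac) = (\<Sum>j\<in>{n<..<0}. hop d j (hop d (n - j) vac))"
      by (rule sum.cong) (auto simp: nord_def)
    finally show ?thesis
      using n by (simp add: nord_def hop_zero lin_simps[OF lin_hop] flip: sc.scale_left_distrib)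
  qed
  show ?thesis
    unfolding lop_def sug sum.distrib sc.scale_sum_right[symmetric]
    by (rule poly_mapping_eqI) (simp add: lookups algebra_simps)
qed

section \<open>The Virasoro relation\<close>

text \<open>The constant term, which serves as the vacuum expectation value: everything in the image
  of a creation mode lies in its kernel.\<close>

definition ep :: "fpoly \<Rightarrow> complex" where "ep p = lookup p {#}"

lemma ep_simps: "ep (p + q) = ep p + ep q" "ep (p - q) = ep p - ep q" "ep (- p) = - ep p" "ep (sc c p) = c * ep p" "ep 0 = 0"
  "ep vac = 1" "ep (sum f A) = (\<Sum>a\<in>A. ep (f a))"
  by (simp_all add: ep_def lookups vac_def lookup_one lookup_sum)

lemma ep_zop: "k < 0 \<Longrightarrow> ep (zop e k p) = 0"
  by (simp add: zop_def ep_def lookup_mul)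

lemma ep_hop: "k < 0 \<Longrightarrow> ep (hop e k p) = 0"
  by (cases e) (simp_all add: hop.simps ep_simps ep_zop)

text \<open>Moving \<open>L(n)\<close> past a creation mode leaves creation modes in front and no
  scalar term, since a sum of two negative indices is not 0.\<close>

lemma ep_lop_neg: "n < 0 \<Longrightarrow> ep (lop n p) = 0"
proof (induction p rule: mul_induct)
  case vac
  then show ?case by (auto simp: lop_neg_vac ep_simps ep_hop intro!: sum.neutral)
next
  case (mul v p)
  then show ?case by (cases v) (simp add: mul_zop lop_zop ep_simps ep_zop)
qed (simp_all add: lin_simps[OF lin_lop] ep_simps)

lemma ep_lop_zero: "ep (lop 0 p) = h0 * ep p"
proof (induction p rule: mul_induct)
  case vac
  then show ?case by (auto simp: lop_zero_vac ep_simps)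
next
  case (mul v p)
  then show ?case by (cases v) (simp add: mul_zop lop_zop ep_simps ep_zop)
qed (simp_all add: lin_simps[OF lin_lop] ep_simps algebra_simps)

lemma ep_hop_pair: "l < 0 \<Longrightarrow> ep (hop d k (hop d l vac)) = cc d k d l"
proof -
  assume l: "l < 0"
  have "ep (hop d l (hop d k vac)) = 0" by (rule ep_hop[OF l])
  then show ?thesis by (simp add: hop_commute[of d k d l] ep_simps)
qed

lemma ep_lop_pair:
  assumes "m > 0" "j < 0" "l < 0"
  shows "ep (lop m (hop d j (hop d l vac))) = - of_int j * cc d (m + j) d l"
proof -
  have "lop m (hop d j (hop d l vac)) = hop d j (lop m (hop d l vac)) + sc (- of_int j) (hop d (m + j) (hop d l vac))
     + sc (if m + j = 0 then - (of_int m ^ 2 + of_int m) * bg d else 0) (hop d l vac)"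
    by (rule lop_hop)
  then show ?thesis using assms by (simp add: ep_simps ep_hop ep_hop_pair)
qed

lemma ep_lop_single:
  assumes "m > 0" "n < 0"
  shows "ep (lop m (hop d n vac)) = (if m + n = 0 then of_int m * hw d - (of_int m ^ 2 + of_int m) * bg d else 0)"
proof -
  have L: "lop m (hop d n vac) = sc (- of_int n) (hop d (m + n) vac)
     + sc (if m + n = 0 then - (of_int m ^ 2 + of_int m) * bg d else 0) vac"
    using assms by (simp add: lop_hop lop_pos_vac lin_zero[OF lin_hop])
  consider "m + n = 0" | "m + n > 0" | "m + n < 0" by linarith
  then show ?thesis
  proof cases
    case 1
    then have "n = - m" by simp
    then show ?thesis unfolding L by (simp add: ep_simps hop_zero algebra_simps)
  qed (simp_all add: L ep_simps hop_vac ep_hop)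
qed

text \<open>The only place where the central charge is computed. After expanding
  \<open>lop n vac\<close>, linear terms carry the background charge and quadratic terms the
  contribution of two free bosons.\<close>

lemma ep_lop_lop_vac:
  assumes "m > 0" "n < 0"
  shows "ep (lop m (lop n vac)) = (if m + n = 0 then 2 * of_int m * h0 + (of_int m ^ 3 - of_int m) / 12 * cL else 0)"
proof -
  have pair: "ep (lop m (hop d j (hop d (n - j) vac))) = (if m + n = 0 then - of_int j * (of_int m + of_int j) * hform d d else 0)"
    if "j \<in> {n<..<0}" for d j
    using that assms by (simp add: ep_lop_pair) (auto simp: cc_def)
  \<comment> \<open>The minus sign before the second term cancels the norm -1 of \<beta>, so both
    bosons contribute equally.\<close>
  have sum: "(\<Sum>j\<in>{n<..<0}. (1/2) * ep (lop m (hop Alpha j (hop Alpha (n - j) vac))) - (1/2) * ep (lop m (hop Beta j (hop Beta (n - j) vac))))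
      = (if m + n = 0 then (of_int m ^ 3 - of_int m) / 6 else 0)"
  proof (cases "m + n = 0")
    case True
    define k where "k = nat m"
    have k: "m = int k" "n = - int k" using True assms by (auto simp: k_def)
    have "(\<Sum>j\<in>{n<..<0}. (1/2) * ep (lop m (hop Alpha j (hop Alpha (n - j) vac))) - (1/2) * ep (lop m (hop Beta j (hop Beta (n - j) vac))))
      = (\<Sum>j\<in>{n<..<0}. - of_int j * (of_nat k + of_int j))"
      by (intro sum.cong refl, subst (1 2) pair) (simp_all add: True, simp add: k(1))
    also have "\<dots> = (\<Sum>j\<in>{- int k<..<0}. - of_int j * (of_nat k + of_int j))"
      by (simp add: k(2))
    also have "\<dots> = (of_int m ^ 3 - of_int m) / 6"
      unfolding sum_int_products by (simp add: k field_simps power3_eq_cube)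
    finally show ?thesis using True by simp
  next
    case False
    then show ?thesis by (simp add: pair)
  qed
  have "ep (lop m (lop n vac)) = (r - (of_int n + 1) * la) * ep (lop m (hop Alpha n vac)) + (s - (of_int n + 1) * mb) * ep (lop m (hop Beta n vac))
    + (\<Sum>j\<in>{n<..<0}. (1/2) * ep (lop m (hop Alpha j (hop Alpha (n - j) vac))) - (1/2) * ep (lop m (hop Beta j (hop Beta (n - j) vac))))"
    by (simp add: lop_neg_vac[OF assms(2)] lin_simps[OF lin_lop] lin_sum[OF lin_lop] ep_simps)
  also have "\<dots> = (if m + n = 0 then 2 * of_int m * h0 + (of_int m ^ 3 - of_int m) / 12 * cL else 0)"
  proof (cases "m + n = 0")
    case True
    \<comment> \<open>A polynomial identity with central charge \<open>2 - 12 * (a^2 - b^2)\<close>;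
      at \<open>a = la\<close>, \<open>b = mb\<close> this is \<open>cL\<close>.\<close>
    have "(r - (of_int n + 1) * a) * (of_int m * r - (of_int m ^ 2 + of_int m) * a)
        + (s - (of_int n + 1) * b) * (of_int m * (- s) - (of_int m ^ 2 + of_int m) * (- b)) + (of_int m ^ 3 - of_int m) / 6
      = 2 * of_int m * (r ^ 2 / 2 - s ^ 2 / 2 - a * r + b * s) + (of_int m ^ 3 - of_int m) / 12 * (2 - 12 * (a^2 - b^2))" for a b
    proof -
      have n: "n = - m" using True by simp
      show ?thesis by (simp add: n) (simp add: field_simps power2_eq_square power3_eq_cube)
    qed
    from this[of la mb] show ?thesis
      unfolding sum ep_lop_single[OF assms] la_mb(3) using True by (simp add: bg_def Delta_def)
  next
    case False
    then show ?thesis unfolding sum ep_lop_single[OF assms] by simp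
  qed
  finally show ?thesis .
qed

text \<open>The defect of the Virasoro relation, to be shown to be 0.\<close>

definition vdef :: "int \<Rightarrow> int \<Rightarrow> fpoly \<Rightarrow> fpoly" where
  "vdef m n p = lop m (lop n p) - lop n (lop m p) - sc (of_int (m - n)) (lop (m + n) p)
     - sc (if m + n = 0 then (of_int m ^ 3 - of_int m) / 12 * cL else 0) p"

lemma lin_vdef: "lin (vdef m n)"
  unfolding vdef_def by (rule linI) (auto intro!: poly_mapping_eqI simp: lin_simps[OF lin_lop] lookups algebra_simps)

text \<open>Each \<open>L(m)\<close> acts on Heisenberg modes by a shift of the index plus a scalar.
  The shifts satisfy the Witt relation and the scalars the matching cocycle condition, so the defect
  commutes with the modes.\<close>

lemma vdef_hop: "vdef m n (hop e k p) = hop e k (vdef m n p)"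
proof (rule poly_mapping_eqI)
  fix x
  have a: "lop a (lop b (hop e k p)) = hop e k (lop a (lop b p)) + sc (- of_int k) (hop e (a + k) (lop b p))
     + sc (if a + k = 0 then - (of_int a ^ 2 + of_int a) * bg e else 0) (lop b p)
     + sc (- of_int k) (hop e (b + k) (lop a p) + sc (- of_int (b + k)) (hop e (a + (b + k)) p)
       + sc (if a + (b + k) = 0 then - (of_int a ^ 2 + of_int a) * bg e else 0) p)
     + sc (if b + k = 0 then - (of_int b ^ 2 + of_int b) * bg e else 0) (lop a p)" for a b
    by (simp only: lop_hop lin_simps[OF lin_lop])
  have swap: "n + (m + k) = m + (n + k)" by simp
  have mnk: "m + n + k = m + (n + k)" by simp
  show "lookup (vdef m n (hop e k p)) x = lookup (hop e k (vdef m n p)) x"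
  proof (cases "m + (n + k) = 0")
    case True
    then have k: "k = - m - n" by simp
    then have kk: "of_int k = - of_int m - (of_int n :: complex)" by simp
    show ?thesis
      unfolding vdef_def a swap lop_hop[of "m + n"] mnk
      by (simp add: True lin_simps[OF lin_hop] lookups kk power2_eq_square algebra_simps)
  next
    case False
    then show ?thesis
      unfolding vdef_def a swap lop_hop[of "m + n"] mnk
      by (simp add: lin_simps[OF lin_hop] lookups algebra_simps)
  qed
qed

text \<open>The vacuum generates all polynomials under creation modes, so an operator commuting with
  them is determined by its value there.\<close>

lemma commutant_zero:
  assumes "lin D" "\<And>e k p. D (hop e k p) = hop e k (D p)" "D vac = 0"
  shows "D p = 0"
proof (induction p rule: mul_induct)
  case (mul v p)
  have "D (zop d k p) = 0" for d k
    using mul by (cases d) (simp_all add: zop_hop lin_simps[OF assms(1)] assms(2) lin_simps[OF lin_hop])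
  then show ?case by (cases v) (simp add: mul_zop)
qed (simp_all add: assms(3) lin_simps[OF assms(1)])

text \<open>Positive modes kill the vacuum and commute with the defect, so they kill the defect of
  the vacuum. All its derivatives then vanish, it is a constant, and \<open>ep\<close> determines
  that constant.\<close>

lemma vdef_zero: "vdef m n p = 0"
proof -
  \<comment> \<open>By antisymmetry \<open>m \<ge> n\<close> suffices; then only
    \<open>n < 0 < m\<close> requires the computation of \<open>ep_lop_lop_vac\<close>.\<close>
  have ge: "vdef m n p = 0" if "m \<ge> n" for m n p
  proof (rule commutant_zero[OF lin_vdef vdef_hop])
    have "hop e k (vdef m n vac) = 0" if "k > 0" for e k
      using that by (simp flip: vdef_hop add: hop_vac lin_zero[OF lin_vdef])
    then have "zop e k (vdef m n vac) = 0" if "k > 0" for e k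
      using that by (cases e) (simp_all add: zop_hop)
    then have dz: "dd v (vdef m n vac) = 0" for v
    proof -
      obtain d i where v: "v = (d, i)" by force
      have "sc (2 * of_int (int i + 1)) (dd v (vdef m n vac)) = zop (dual d) (int i + 1) (vdef m n vac)"
        by (cases d) (simp_all add: zop_def v)
      also have "\<dots> = 0" by (rule \<open>\<And>k e. k > 0 \<Longrightarrow> zop e k (vdef m n vac) = 0\<close>) simp
      finally have "sc (2 * of_int (int i + 1)) (dd v (vdef m n vac)) = 0" .
      moreover have "2 * of_int (int i + 1) \<noteq> (0 :: complex)"
        by (metis mult_eq_0_iff of_int_eq_0_iff zero_neq_numeral add_pos_nonneg add.commute of_nat_0_le_iff less_irrefl zero_less_one)
      ultimately show ?thesis by (simp only: sc.scale_eq_0_iff) simp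
    qed
    have eh: "ep (lop k vac) = (if k = 0 then h0 else 0)" for k
    proof -
      consider "k < 0" | "k = 0" | "k > 0" by linarith
      then show ?thesis by cases (auto simp: ep_lop_neg lop_pos_vac lop_zero_vac ep_simps)
    qed
    have "ep (lop m (lop n vac)) - ep (lop n (lop m vac))
      = of_int (m - n) * ep (lop (m + n) vac) + (if m + n = 0 then (of_int m ^ 3 - of_int m) / 12 * cL else 0)"
    proof -
      consider "n < 0" "m > 0" | "n < 0" "m = 0" | "n < 0" "m < 0" | "n = 0" | "n > 0" by linarith
      then show ?thesis
      proof cases
        case 1
        then show ?thesis by (auto simp: ep_lop_lop_vac ep_lop_neg eh add_eq_0_iff2)
      next
        case 4
        then show ?thesis using \<open>m \<ge> n\<close>
          by (cases "m = 0") (auto simp: lop_zero_vac lop_pos_vac lin_simps[OF lin_lop] ep_simps)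
      qed (use \<open>m \<ge> n\<close> in \<open>auto simp: ep_lop_neg ep_lop_zero eh lop_zero_vac lop_pos_vac lin_simps[OF lin_lop] ep_simps\<close>)
    qed
    then have "ep (vdef m n vac) = 0"
      by (simp add: vdef_def ep_simps)
    then show "vdef m n vac = 0"
      using dd_zero_imp_scalar[OF dz] by (simp add: ep_def)
  qed
  show ?thesis
  proof (cases "m \<ge> n")
    case False
    have "vdef m n p = - vdef n m p"
    proof (rule poly_mapping_eqI)
      fix x
      have "of_int m = - (of_int n :: complex)" if "m + n = 0" using that by (simp add: add_eq_0_iff2)
      then show "lookup (vdef m n p) x = lookup (- vdef n m p) x"
        by (cases "m + n = 0") (simp_all add: vdef_def lookups add.commute[of n m] algebra_simps power3_eq_cube
            add_divide_distrib diff_divide_distrib)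
    qed
    then show ?thesis using ge[of m n] False by simp
  qed (rule ge)
qed

end

section \<open>The weight filtration and the triangular action on the Verma module\<close>

text \<open>Index \<open>i\<close> stands for mode \<open>-(i + 1)\<close>, so \<open>i + 2\<close>
  is the mode number plus 1.\<close>

definition var_wt :: "hbasis \<times> nat \<Rightarrow> nat" where
  "var_wt v = (case v of (Alpha, _) \<Rightarrow> 0 | (Beta, i) \<Rightarrow> i + 2)"

definition mon_wt :: "(hbasis \<times> nat) multiset \<Rightarrow> nat" where
  "mon_wt M = sum_mset (image_mset var_wt M)"

definition below :: "nat \<Rightarrow> fpoly \<Rightarrow> bool" where
  "below K p \<longleftrightarrow> (\<forall>M\<in>keys p. mon_wt M < K)"

lemma mon_wt_simps [simp]: "mon_wt {#} = 0" "mon_wt (add_mset v M) = var_wt v + mon_wt M"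
  by (simp_all add: mon_wt_def)

lemma below_iff: "below K p \<longleftrightarrow> (\<forall>M. lookup p M \<noteq> 0 \<longrightarrow> mon_wt M < K)"
  by (auto simp: below_def in_keys_iff)

lemma below_zero: "below K 0"
  and below_add: "below K p \<Longrightarrow> below K q \<Longrightarrow> below K (p + q)"
  and below_sc: "below K p \<Longrightarrow> below K (sc c p)"
  by (auto simp: below_iff lookups) (metis add_0)

lemma below_sum: "(\<And>a. a \<in> A \<Longrightarrow> below K (f a)) \<Longrightarrow> below K (sum f A)"
  by (induction A rule: infinite_finite_induct) (auto intro: below_zero below_add)

lemma below_mono: "below K p \<Longrightarrow> K \<le> L \<Longrightarrow> below L p"
  by (auto simp: below_def)

lemma below_mul:
  assumes "below K p"
  shows "below (var_wt v + K) (mul v p)"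
  unfolding below_iff
proof (intro allI impI)
  fix M assume "lookup (mul v p) M \<noteq> 0"
  then have M: "v \<in># M" "lookup p (M - {#v#}) \<noteq> 0" by (auto simp: lookup_mul split: if_splits)
  then obtain N where "M = add_mset v N" by (metis insert_DiffM)
  then show "mon_wt M < var_wt v + K" using M assms by (auto simp: below_iff)
qed

lemma below_single: "mon_wt M < K \<Longrightarrow> below K (Poly_Mapping.single M c)"
  by (auto simp: below_iff lookup_single when_def)

context free_field
begin

fun hv_op :: "hv \<Rightarrow> fpoly \<Rightarrow> fpoly" where
  "hv_op (hvL n) p = lop n p"
| "hv_op (hvI n) p = zop Alpha n p"
| "hv_op hvCL p = sc cL p"
| "hv_op hvCLI p = sc cLI p"
| "hv_op hvCI p = sc 0 p"

lemma lin_hv_op: "lin (hv_op x)"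
  by (rule linI; cases x) (simp_all add: lin_simps[OF lin_lop] lin_simps[OF lin_zop] sc.scale_right_distrib mult.commute)

lemma lop_commute:
  "lop m (lop n p) - lop n (lop m p) = sc (of_int (m - n)) (lop (m + n) p)
     + sc (if m + n = 0 then (of_int m ^ 3 - of_int m) / 12 * cL else 0) p"
proof -
  have "a - b = c + d" if "a - b - c - d = 0" for a b c d :: fpoly
    using that by (simp add: algebra_simps)
  from this[OF vdef_zero[of m n p, unfolded vdef_def]] show ?thesis .
qed

text \<open>The scalar term for \<alpha> + \<beta> involves \<open>la - mb\<close>, which equals
  \<open>cLI\<close>: this is where the second central charge arises.\<close>

lemma hv_op_bracket_LI:
  "lop n (zop Alpha m p) - zop Alpha m (lop n p) = act hv_op (hv_bracket (hvL n) (hvI m)) p"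
  unfolding lop_zop[of n Alpha m p]
  by (cases "n + m = 0") (auto intro!: poly_mapping_eqI
    simp: act_diff act_mult[OF lin_hv_op] lookups la_mb(1) add_eq_0_iff2 algebra_simps)

lemma hv_op_bracket: "hv_op x (hv_op y p) - hv_op y (hv_op x p) = act hv_op (hv_bracket x y) p"
proof (cases "(x, y)" rule: hv_bracket.cases)
  case (1 n m)
  have "n = - m \<longleftrightarrow> n + m = 0" by auto
  then show ?thesis using 1 lop_commute[of n m p]
    by (simp add: act_add act_mult[OF lin_hv_op] mult.commute)
next
  case (2 n m)
  then show ?thesis using hv_op_bracket_LI by simp
next
  case (3 m n)
  have "hv_bracket x y = - hv_bracket (hvL n) (hvI m)" using 3 by simp
  then have "act hv_op (hv_bracket x y) p = - (lop n (zop Alpha m p) - zop Alpha m (lop n p))"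
    by (simp only: act_uminus hv_op_bracket_LI)
  then show ?thesis using 3 by simp
next
  case (4 n m)
  then show ?thesis by (simp add: zop_commute[of Alpha n Alpha m p] act_mult[OF lin_hv_op])
qed (auto simp: act_zero lin_simps[OF lin_lop] lin_simps[OF lin_zop] mult.commute
    lin_sc[OF lin_hv_op] lin_zero[OF lin_hv_op])

abbreviation "verma0 \<equiv> verma_ideal cL 0 cLI h0 (r - s)"

lemma verma_ideal_annihilates: "t \<in> verma0 \<Longrightarrow> act hv_op t vac = 0"
  unfolding verma_ideal_def
proof (rule induced_ideal_annihilates[OF lin_hv_op hv_op_bracket])
  show "hv_op x vac = sc (hv_weight cL 0 cLI h0 (r - s) x) vac" if "x \<in> {x. hv_nonneg x}" for x
    using that by (cases x) (auto simp: zop_vac lop_zero_vac lop_pos_vac)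
qed auto

text \<open>The index type of the polynomial variables is reused, so that the word of content
  \<open>N\<close> can have the monomial \<open>N\<close> as its leading term.\<close>

fun hv_letter :: "hbasis \<times> nat \<Rightarrow> hv tensor" where
  "hv_letter (Alpha, i) = gen (hvI (- int i - 1))"
| "hv_letter (Beta, i) = gen (hvL (- int i - 1))"

lemma straightening_verma: "straightening verma0 hv_letter (gen ` {x. hv_nonneg x}) word_of"
  unfolding verma_ideal_def
proof (rule straightening_induced_ideal)
  show "hv_letter v \<in> sc.span (range gen)" for v
    by (cases v rule: hv_letter.cases) (auto intro: sc.span_base)
  show "hv_bracket x y \<in> sc.span (range gen)" for x y
    by (cases "(x, y)" rule: hv_bracket.cases)
       (auto simp: scal_mult simp del: sc.scale_left_commute
         intro!: sc.span_neg sc.span_add sc.span_diff sc.span_scale sc.span_zero intro: sc.span_base)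
  show "gen x \<in> sc.span (range hv_letter \<union> gen ` {x. hv_nonneg x})" for x
  proof (cases "hv_nonneg x")
    case False
    then consider n where "x = hvL n" "n < 0" | n where "x = hvI n" "n < 0" by (cases x) auto
    then have "gen x \<in> range hv_letter"
    proof cases
      case (1 n)
      then show ?thesis by (intro image_eqI[of _ _ "(Beta, nat (- n - 1))"]) auto
    next
      case (2 n)
      then show ?thesis by (intro image_eqI[of _ _ "(Alpha, nat (- n - 1))"]) auto
    qed
    then show ?thesis by (auto intro: sc.span_base)
  qed (auto intro: sc.span_base)
qed

text \<open>The coefficient of \<open>(\<alpha> - \<beta>)(-i-1)\<close> in \<open>L(-i-1)\<close>.\<close>

definition top_coeff :: "nat \<Rightarrow> complex" where
  "top_coeff i = (r - s + of_nat i * cLI) / 2"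

text \<open>Passing to isotropic variables turns the difference of the \<alpha> and \<beta>
  coefficients into that of the \<open>Beta\<close> variable. A quadratic term contains exactly one
  \<open>Beta\<close> variable, of index less than \<open>i\<close>, and is therefore lower.\<close>

lemma lop_neg_vac_leading:
  "\<exists>q. lop (- int i - 1) vac = sc (top_coeff i) (mul (Beta, i) vac) + q \<and> below (var_wt (Beta, i)) q"
proof -
  define n where "n = - int i - 1"
  \<comment> \<open>The coefficient of the \<open>Alpha\<close> variable: half the sum of the two
    linear coefficients. That term has weight 0.\<close>
  define c where "c = ((r + s) + of_nat i * (la + mb)) / 2"
  define q where "q = sc c (mul (Alpha, i) vac) + (\<Sum>j\<in>{n<..<0}. sc (1/4)
    (mul (Alpha, nat (- j - 1)) (mul (Beta, nat (- (n - j) - 1)) vac) +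
     mul (Beta, nat (- j - 1)) (mul (Alpha, nat (- (n - j) - 1)) vac)))"
  have n: "n < 0" "of_int n + 1 = - (of_nat i :: complex)" by (simp_all add: n_def)
  have pair: "sc (1/2) (hop Alpha j (hop Alpha l vac)) + sc (-1/2) (hop Beta j (hop Beta l vac))
    = sc (1/4) (mul (Alpha, nat (- j - 1)) (mul (Beta, nat (- l - 1)) vac) +
        mul (Beta, nat (- j - 1)) (mul (Alpha, nat (- l - 1)) vac))" if "j < 0" "l < 0" for j l
    using that by (intro poly_mapping_eqI)
      (simp add: hop.simps zop_def lin_simps[OF lin_mul] lookups field_simps)
  have top: "top_coeff i = (r - s + of_nat i * (la - mb)) / 2"
    by (simp only: top_coeff_def la_mb(1))
  have lin_part: "sc (r - (of_int n + 1) * la) (hop Alpha n vac) + sc (s - (of_int n + 1) * mb) (hop Beta n vac)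
    = sc (top_coeff i) (mul (Beta, i) vac) + sc c (mul (Alpha, i) vac)"
  proof (rule poly_mapping_eqI)
    fix x
    have "zop d n vac = mul (d, i) vac" for d by (simp add: zop_def n_def)
    moreover have "(r - - of_nat i * a) * ((1/2) * (u + v)) + (s - - of_nat i * b) * ((1/2) * (u - v))
      = (r - s + of_nat i * (a - b)) / 2 * v + ((r + s) + of_nat i * (a + b)) / 2 * u" for a b u v
      by (simp add: field_simps)
    ultimately show "lookup (sc (r - (of_int n + 1) * la) (hop Alpha n vac) + sc (s - (of_int n + 1) * mb) (hop Beta n vac)) x
      = lookup (sc (top_coeff i) (mul (Beta, i) vac) + sc c (mul (Alpha, i) vac)) x"
      unfolding top c_def n(2) by (simp only: hop.simps lookups)
  qed
  have "lop n vac = sc (top_coeff i) (mul (Beta, i) vac) + q"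
    unfolding lop_neg_vac[OF n(1)] lin_part q_def add.assoc
    by (intro arg_cong2[of _ _ _ _ "(+)"] refl sum.cong pair) auto
  moreover have "below (var_wt (Beta, i)) q"
    unfolding q_def vac_def mul_single
    by (intro below_add below_sc below_sum below_single) (auto simp: var_wt_def n_def)
  ultimately show ?thesis unfolding n_def by blast
qed

text \<open>Induction over the monomial. Passing the variable \<open>(e, j)\<close> creates
  \<open>j + 1\<close> times the variable \<open>(e, i + j + 1)\<close>; for \<open>Beta\<close> its
  weight \<open>i + j + 3\<close> is one less than the combined weight
  \<open>(i + 2) + (j + 2)\<close>, for \<open>Alpha\<close> it is 0.\<close>

lemma lop_neg_single:
  "\<exists>q. lop (- int i - 1) (Poly_Mapping.single M 1) = sc (top_coeff i) (Poly_Mapping.single (add_mset (Beta, i) M) 1) + q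
     \<and> below (var_wt (Beta, i) + mon_wt M) q"
proof (induction M)
  case empty
  show ?case using lop_neg_vac_leading[of i] unfolding vac_def mul_single by simp
next
  case (add v M)
  obtain e j where v: "v = (e, j)" by force
  obtain q where q: "lop (- int i - 1) (Poly_Mapping.single M 1) = sc (top_coeff i) (Poly_Mapping.single (add_mset (Beta, i) M) 1) + q"
     "below (var_wt (Beta, i) + mon_wt M) q" using add by blast
  define q' where "q' = mul v q + sc (of_nat j + 1) (Poly_Mapping.single (add_mset (e, i + j + 1) M) 1)"
  have "lop (- int i - 1) (Poly_Mapping.single (add_mset v M) 1)
      = lop (- int i - 1) (zop e (- int j - 1) (Poly_Mapping.single M 1))"
    by (simp flip: mul_zop add: v mul_single)
  also have "\<dots> = zop e (- int j - 1) (lop (- int i - 1) (Poly_Mapping.single M 1))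
      + sc (of_nat j + 1) (zop e (- int (i + j + 1) - 1) (Poly_Mapping.single M 1))"
    unfolding lop_zop by (simp add: algebra_simps)
  also have "\<dots> = sc (top_coeff i) (Poly_Mapping.single (add_mset (Beta, i) (add_mset v M)) 1) + q'"
    unfolding mul_zop[symmetric] q(1) q'_def
    by (simp only: lin_simps[OF lin_mul] mul_single v add_mset_commute add.assoc)
  finally have eq: "lop (- int i - 1) (Poly_Mapping.single (add_mset v M) 1)
    = sc (top_coeff i) (Poly_Mapping.single (add_mset (Beta, i) (add_mset v M)) 1) + q'" .
  have "below (var_wt (Beta, i) + mon_wt (add_mset v M)) (mul v q)"
    using below_mul[OF q(2), of v] by (simp add: add_ac)
  moreover have "below (var_wt (Beta, i) + mon_wt (add_mset v M)) (Poly_Mapping.single (add_mset (e, i + j + 1) M) 1)"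
    by (rule below_single) (cases e; simp add: v var_wt_def)
  ultimately have "below (var_wt (Beta, i) + mon_wt (add_mset v M)) q'"
    unfolding q'_def by (intro below_add below_sc)
  with eq show ?case by blast
qed

lemma lop_neg_below:
  assumes "below K p"
  shows "below (var_wt (Beta, i) + K) (lop (- int i - 1) p)"
proof -
  have "below (var_wt (Beta, i) + K) (lop (- int i - 1) (Poly_Mapping.single M 1))" if "mon_wt M < K" for M
  proof -
    obtain q where q: "lop (- int i - 1) (Poly_Mapping.single M 1) = sc (top_coeff i) (Poly_Mapping.single (add_mset (Beta, i) M) 1) + q"
     "below (var_wt (Beta, i) + mon_wt M) q" using lop_neg_single by blast
    show ?thesis unfolding q(1)
      using that by (intro below_add below_sc below_single below_mono[OF q(2)]) auto
  qed
  moreover have "lop (- int i - 1) p = (\<Sum>M\<in>keys p. sc (lookup p M) (lop (- int i - 1) (Poly_Mapping.single M 1)))"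
    by (subst poly_mapping_expand[of "keys p" p]) (simp_all add: lin_sum[OF lin_lop] lin_sc[OF lin_lop])
  ultimately show ?thesis using assms
    by (auto simp: below_def[of K] intro!: below_sum below_sc)
qed

definition lead :: "(hbasis \<times> nat) multiset \<Rightarrow> complex" where
  "lead M = prod_mset (image_mset (\<lambda>v. case v of (Alpha, _) \<Rightarrow> 1 | (Beta, i) \<Rightarrow> top_coeff i) M)"

text \<open>The leading term depends only on the content of the word, which is why an arbitrary
  choice \<open>word_of\<close> is good enough.\<close>

lemma hv_word_leading:
  "\<exists>q. act hv_op (prod_list (map hv_letter l)) vac = sc (lead (mset l)) (Poly_Mapping.single (mset l) 1) + q
     \<and> below (mon_wt (mset l)) q"
proof (induction l)
  case Nil
  show ?case by (intro exI[of _ 0]) (simp add: lead_def below_zero vac_def)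
next
  case (Cons v l)
  let ?M = "mset l"
  obtain q where q: "act hv_op (prod_list (map hv_letter l)) vac = sc (lead ?M) (Poly_Mapping.single ?M 1) + q"
    "below (mon_wt ?M) q" using Cons by blast
  obtain e i where v: "v = (e, i)" by force
  show ?case
  proof (cases e)
    case Alpha
    have "act hv_op (prod_list (map hv_letter (v # l))) vac = mul v (sc (lead ?M) (Poly_Mapping.single ?M 1) + q)"
      by (simp add: act_mult[OF lin_hv_op] q(1) v Alpha mul_zop)
    also have "\<dots> = sc (lead (mset (v # l))) (Poly_Mapping.single (mset (v # l)) 1) + mul v q"
      by (simp add: lin_simps[OF lin_mul] mul_single lead_def v Alpha)
    finally show ?thesis using below_mul[OF q(2), of v] by auto
  next
    case Beta
    obtain q' where q': "lop (- int i - 1) (Poly_Mapping.single ?M 1) = sc (top_coeff i) (Poly_Mapping.single (add_mset (Beta, i) ?M) 1) + q'"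
     "below (var_wt (Beta, i) + mon_wt ?M) q'" using lop_neg_single by blast
    have "act hv_op (prod_list (map hv_letter (v # l))) vac = lop (- int i - 1) (sc (lead ?M) (Poly_Mapping.single ?M 1) + q)"
      by (simp add: act_mult[OF lin_hv_op] q(1) v Beta)
    also have "\<dots> = sc (lead ?M) (sc (top_coeff i) (Poly_Mapping.single (add_mset (Beta, i) ?M) 1) + q') + lop (- int i - 1) q"
      by (simp only: lin_simps[OF lin_lop] q'(1))
    also have "\<dots> = sc (lead (mset (v # l))) (Poly_Mapping.single (mset (v # l)) 1) + (sc (lead ?M) q' + lop (- int i - 1) q)"
      by (simp add: lead_def v Beta sc.scale_right_distrib mult.commute)
    finally show ?thesis
      using below_add[OF below_sc[OF q'(2)] lop_neg_below[OF q(2)]] by (auto simp: v Beta)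
  qed
qed

abbreviation verma_map :: "hv tensor set \<Rightarrow> fpoly" where
  "verma_map \<equiv> orbit_map hv_op vac"

lemma verma_iso:
  assumes "\<And>i. top_coeff i \<noteq> 0"
  shows "linear_iso (verma cL 0 cLI h0 (r - s)) pmod verma_map"
proof -
  interpret straightening verma0 hv_letter "gen ` {x. hv_nonneg x}" word_of
    by (rule straightening_verma)
  have "\<exists>q. act hv_op (ordered N) vac = sc (lead N) (Poly_Mapping.single N 1) + q \<and> below (mon_wt N) q" for N
    using hv_word_leading[of "word_of N"] by (simp add: ordered_def)
  then obtain q where q: "\<And>N. act hv_op (ordered N) vac = sc (lead N) (Poly_Mapping.single N 1) + q N"
    "\<And>N. below (mon_wt N) (q N)" by metis
  have lead: "lead N \<noteq> 0" for N
    using assms by (auto simp: lead_def split: prod.splits hbasis.splits)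
  show ?thesis
    unfolding verma_def
    by (rule quotient_iso[where \<kappa> = mon_wt, OF lin_hv_op verma_ideal_annihilates lead q(1)]) (use q(2) in \<open>auto simp: below_def\<close>)
qed

lemma verma_map_rep:
  "w \<in> carrier (verma cL 0 cLI h0 (r - s)) \<Longrightarrow> verma_map (verma_rep cL 0 cLI h0 (r - s) x w) = hv_op x (verma_map w)"
  unfolding verma_rep_def verma_def
  by (subst orbit_map_coset_act[OF _ verma_ideal_annihilates lin_hv_op])
     (auto simp: verma_ideal_def left_ideal_induced_ideal)

text \<open>The tensor 1 fixes the nonzero vacuum. With \<open>r = s = 0\<close> this shows that the
  universal vacuum module is nonzero.\<close>

lemma one_notin_verma_ideal: "1 \<notin> verma0"
  using verma_ideal_annihilates[of 1] ep_simps(5,6) by (metis act_one ep_simps(5) zero_neq_one)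

end

section \<open>Transport of module structures\<close>

lemma linear_isoD:
  assumes "linear_iso V W \<Phi>"
  shows "bij_betw \<Phi> (carrier V) (carrier W)"
    "x \<in> carrier V \<Longrightarrow> \<Phi> x \<in> carrier W"
    "x \<in> carrier V \<Longrightarrow> y \<in> carrier V \<Longrightarrow> \<Phi> (x \<oplus>\<^bsub>V\<^esub> y) = \<Phi> x \<oplus>\<^bsub>W\<^esub> \<Phi> y"
    "x \<in> carrier V \<Longrightarrow> \<Phi> (c \<odot>\<^bsub>V\<^esub> x) = c \<odot>\<^bsub>W\<^esub> \<Phi> x"
    "x \<in> carrier V \<Longrightarrow> y \<in> carrier V \<Longrightarrow> \<Phi> x = \<Phi> y \<longleftrightarrow> x = y"
    "z \<in> carrier W \<Longrightarrow> inv_into (carrier V) \<Phi> z \<in> carrier V"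
    "z \<in> carrier W \<Longrightarrow> \<Phi> (inv_into (carrier V) \<Phi> z) = z"
    "x \<in> carrier V \<Longrightarrow> inv_into (carrier V) \<Phi> (\<Phi> x) = x"
proof -
  show b: "bij_betw \<Phi> (carrier V) (carrier W)" using assms by (simp add: linear_iso_def)
  show "x \<in> carrier V \<Longrightarrow> \<Phi> x \<in> carrier W" using b by (rule bij_betwE[rule_format])
  show "x \<in> carrier V \<Longrightarrow> y \<in> carrier V \<Longrightarrow> \<Phi> (x \<oplus>\<^bsub>V\<^esub> y) = \<Phi> x \<oplus>\<^bsub>W\<^esub> \<Phi> y"
    "x \<in> carrier V \<Longrightarrow> \<Phi> (c \<odot>\<^bsub>V\<^esub> x) = c \<odot>\<^bsub>W\<^esub> \<Phi> x"
    using assms by (auto simp: linear_iso_def)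
  show "x \<in> carrier V \<Longrightarrow> y \<in> carrier V \<Longrightarrow> \<Phi> x = \<Phi> y \<longleftrightarrow> x = y"
    using b by (auto simp: bij_betw_def inj_on_def)
  show "z \<in> carrier W \<Longrightarrow> inv_into (carrier V) \<Phi> z \<in> carrier V"
    "z \<in> carrier W \<Longrightarrow> \<Phi> (inv_into (carrier V) \<Phi> z) = z"
    using b by (auto simp: bij_betw_def intro: inv_into_into f_inv_into_f)
  show "x \<in> carrier V \<Longrightarrow> inv_into (carrier V) \<Phi> (\<Phi> x) = x"
    using b by (auto simp: bij_betw_def)
qed

lemma complex_ring_carrier [simp]: "x \<in> carrier complex_ring"
  by (simp add: ring_of_type_algebra_def)

lemma complex_ring_zero: "\<zero>\<^bsub>complex_ring\<^esub> = 0" and complex_ring_one: "\<one>\<^bsub>complex_ring\<^esub> = 1"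
  by (simp_all add: ring_of_type_algebra_def)

lemma linear_iso_inv:
  assumes iso: "linear_iso V W \<Phi>" and V: "module complex_ring V"
  shows "linear_iso W V (inv_into (carrier V) \<Phi>)"
proof -
  interpret V: module complex_ring V by (rule V)
  note D = linear_isoD[OF iso]
  let ?\<Psi> = "inv_into (carrier V) \<Phi>"
  have "?\<Psi> (x \<oplus>\<^bsub>W\<^esub> y) = ?\<Psi> x \<oplus>\<^bsub>V\<^esub> ?\<Psi> y" if "x \<in> carrier W" "y \<in> carrier W" for x y
    using D(8)[of "?\<Psi> x \<oplus>\<^bsub>V\<^esub> ?\<Psi> y"] that by (simp add: D(3,6,7))
  moreover have "?\<Psi> (c \<odot>\<^bsub>W\<^esub> x) = c \<odot>\<^bsub>V\<^esub> ?\<Psi> x" if "x \<in> carrier W" for c x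
    using D(8)[of "c \<odot>\<^bsub>V\<^esub> ?\<Psi> x"] that by (simp add: D(4,6,7))
  ultimately show ?thesis
    using bij_betw_inv_into[OF D(1)] by (simp add: linear_iso_def)
qed

lemma linear_iso_comp:
  "linear_iso V W \<Phi> \<Longrightarrow> linear_iso W U \<Psi> \<Longrightarrow> linear_iso V U (\<lambda>x. \<Psi> (\<Phi> x))"
  using bij_betw_trans[of \<Phi> "carrier V" "carrier W" \<Psi> "carrier U"]
  by (auto simp: linear_iso_def o_def dest: bij_betwE)

lemma linear_iso_zero:
  assumes iso: "linear_iso V W \<Phi>" and "abelian_group V" "abelian_group W"
  shows "\<Phi> \<zero>\<^bsub>V\<^esub> = \<zero>\<^bsub>W\<^esub>"
proof -
  interpret V: abelian_group V by fact
  interpret W: abelian_group W by fact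
  have "\<Phi> \<zero>\<^bsub>V\<^esub> = \<Phi> \<zero>\<^bsub>V\<^esub> \<oplus>\<^bsub>W\<^esub> \<Phi> \<zero>\<^bsub>V\<^esub>"
    using linear_isoD(3)[OF iso V.zero_closed V.zero_closed] by simp
  then show ?thesis
    using linear_isoD(2)[OF iso V.zero_closed] by (metis W.add.r_cancel_one')
qed

lemma linear_iso_minus:
  assumes iso: "linear_iso V W \<Phi>" and "abelian_group V" "abelian_group W"
    and x: "x \<in> carrier V" and y: "y \<in> carrier V"
  shows "\<Phi> (x \<ominus>\<^bsub>V\<^esub> y) = \<Phi> x \<ominus>\<^bsub>W\<^esub> \<Phi> y"
proof -
  interpret V: abelian_group V by fact
  interpret W: abelian_group W by fact
  note D = linear_isoD[OF iso]
  have "\<Phi> (\<ominus>\<^bsub>V\<^esub> y) \<oplus>\<^bsub>W\<^esub> \<Phi> y = \<zero>\<^bsub>W\<^esub>"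
    using D(3)[of "\<ominus>\<^bsub>V\<^esub> y" y] y linear_iso_zero[OF assms(1-3)] by (simp add: V.l_neg)
  then have "\<Phi> (\<ominus>\<^bsub>V\<^esub> y) = \<ominus>\<^bsub>W\<^esub> \<Phi> y"
    using W.minus_equality[of "\<Phi> (\<ominus>\<^bsub>V\<^esub> y)" "\<Phi> y"] D(2) y by simp
  then show ?thesis using D(3)[of x "\<ominus>\<^bsub>V\<^esub> y"] x y by (simp add: V.minus_eq W.minus_eq)
qed

text \<open>Injectivity makes the two families have the same support. Infinite support is covered
  too, since both sums then default to zero.\<close>

lemma linear_iso_fin_sum:
  assumes iso: "linear_iso V W \<Phi>" and V: "abelian_group V" and W: "abelian_group W"
    and f: "\<And>j. f j \<in> carrier V"
  shows "\<Phi> (fin_sum V f) = fin_sum W (\<lambda>j. \<Phi> (f j))"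
proof -
  interpret V: abelian_group V by fact
  interpret W: abelian_group W by fact
  note D = linear_isoD[OF iso]
  note zero = linear_iso_zero[OF iso V W]
  have "\<Phi> (finsum V f A) = finsum W (\<lambda>j. \<Phi> (f j)) A" for A
  proof (induction A rule: infinite_finite_induct)
    case (insert a A)
    then show ?case using f by (simp add: D(2,3) Pi_def)
  qed (simp_all add: zero)
  moreover have "{j. \<Phi> (f j) \<noteq> \<zero>\<^bsub>W\<^esub>} = {j. f j \<noteq> \<zero>\<^bsub>V\<^esub>}"
    using D(5)[OF f V.zero_closed] zero by simp
  ultimately show ?thesis by (simp add: fin_sum_def)
qed

lemma fin_sum_singleton:
  assumes "abelian_group W" "\<And>j. j \<noteq> i \<Longrightarrow> f j = \<zero>\<^bsub>W\<^esub>" "f i \<in> carrier W"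
  shows "fin_sum W f = f i"
proof -
  interpret W: abelian_group W by fact
  show ?thesis
  proof (cases "f i = \<zero>\<^bsub>W\<^esub>")
    case True
    then have "{j. f j \<noteq> \<zero>\<^bsub>W\<^esub>} = {}" using assms(2) by (metis (mono_tags, lifting) Collect_empty_eq)
    then show ?thesis using True by (simp add: fin_sum_def)
  next
    case False
    then have "{j. f j \<noteq> \<zero>\<^bsub>W\<^esub>} = {i}" using assms(2) by auto
    then show ?thesis using assms(3) by (simp add: fin_sum_def)
  qed
qed

lemma fin_sum_pmod: "fin_sum pmod f = Sum_any f"
proof -
  interpret P: abelian_group pmod by (rule abelian_group_pmod)
  have "finsum pmod f A = sum f A" for A
    by (induction A rule: infinite_finite_induct) simp_all
  then show ?thesis by (simp add: fin_sum_def Sum_any.expand_set)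
qed

lemma module_abelian_group: "module R M \<Longrightarrow> abelian_group M"
  by (simp add: module_def)

lemma state_field_mapD:
  assumes "state_field_map V W Y" "a \<in> carrier V" "w \<in> carrier W"
  shows "Y a n w \<in> carrier W"
    "b \<in> carrier V \<Longrightarrow> Y (a \<oplus>\<^bsub>V\<^esub> b) n w = Y a n w \<oplus>\<^bsub>W\<^esub> Y b n w"
    "Y (c \<odot>\<^bsub>V\<^esub> a) n w = c \<odot>\<^bsub>W\<^esub> Y a n w"
    "u \<in> carrier W \<Longrightarrow> Y a n (w \<oplus>\<^bsub>W\<^esub> u) = Y a n w \<oplus>\<^bsub>W\<^esub> Y a n u"
    "Y a n (c \<odot>\<^bsub>W\<^esub> w) = c \<odot>\<^bsub>W\<^esub> Y a n w"
    "\<exists>N. \<forall>n\<ge>N. Y a n w = \<zero>\<^bsub>W\<^esub>"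
  using assms by (simp_all add: state_field_map_def)

definition borcherds_term ::
    "(complex, 'w) module \<Rightarrow> ('v \<Rightarrow> 'w field_modes) \<Rightarrow> 'v \<Rightarrow> 'v \<Rightarrow> int \<Rightarrow> int \<Rightarrow> int \<Rightarrow> 'w \<Rightarrow> nat \<Rightarrow> 'w" where
  "borcherds_term W YW a b l m n w j = ((- 1) ^ j * (of_int l gchoose j)) \<odot>\<^bsub>W\<^esub>
     (YW a (m + l - int j) (YW b (n + int j) w)
      \<ominus>\<^bsub>W\<^esub> ((- 1) powi l) \<odot>\<^bsub>W\<^esub> YW b (n + l - int j) (YW a (m + int j) w))"

lemma borcherds_identityD:
  assumes "borcherds_identity V Y W YW" "a \<in> carrier V" "b \<in> carrier V" "w \<in> carrier W"
  shows "fin_sum W (\<lambda>j::nat. (of_int m gchoose j) \<odot>\<^bsub>W\<^esub> YW (Y a (l + int j) b) (m + n - int j) w)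
    = fin_sum W (borcherds_term W YW a b l m n w)"
proof -
  have "borcherds_term W YW a b l m n w = (\<lambda>j. ((- 1) ^ j * (of_int l gchoose j)) \<odot>\<^bsub>W\<^esub>
     (YW a (m + l - int j) (YW b (n + int j) w)
      \<ominus>\<^bsub>W\<^esub> ((- 1) powi l) \<odot>\<^bsub>W\<^esub> YW b (n + l - int j) (YW a (m + int j) w)))"
    by (rule ext) (simp only: borcherds_term_def)
  then show ?thesis
    using assms(1)[unfolded borcherds_identity_def, rule_format, OF assms(2-4), of m l n] by (simp only:)
qed

text \<open>Intertwining is required only for the two states \<open>a\<close> and \<open>b\<close>.
  This serves the transport of a structure as well as the uniqueness proof, where it is known for
  few states at first.\<close>

lemma borcherds_term_iso:
  assumes iso: "linear_iso W U \<Phi>" and W: "module complex_ring W" and U: "module complex_ring U"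
    and YW: "\<And>n w. w \<in> carrier W \<Longrightarrow> YW a n w \<in> carrier W" "\<And>n w. w \<in> carrier W \<Longrightarrow> YW b n w \<in> carrier W"
    and tw: "\<And>n w. w \<in> carrier W \<Longrightarrow> \<Phi> (YW a n w) = YU a n (\<Phi> w)"
      "\<And>n w. w \<in> carrier W \<Longrightarrow> \<Phi> (YW b n w) = YU b n (\<Phi> w)"
    and w: "w \<in> carrier W"
  shows "borcherds_term W YW a b l m n w j \<in> carrier W"
    "\<Phi> (borcherds_term W YW a b l m n w j) = borcherds_term U YU a b l m n (\<Phi> w) j"
proof -
  interpret W: module complex_ring W by (rule W)
  show "borcherds_term W YW a b l m n w j \<in> carrier W"
    unfolding borcherds_term_def by (intro W.smult_closed W.minus_closed YW w complex_ring_carrier)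
  show "\<Phi> (borcherds_term W YW a b l m n w j) = borcherds_term U YU a b l m n (\<Phi> w) j"
    unfolding borcherds_term_def
    by (simp add: linear_isoD(4)[OF iso] linear_iso_minus[OF iso module_abelian_group[OF W] module_abelian_group[OF U]]
        W.minus_closed YW w tw)
qed

lemma vertex_algebra_module_transport:
  assumes mod: "vertex_algebra_module V v0 Y W YW" and U: "module complex_ring U"
    and iso: "linear_iso W U \<Phi>"
  shows "vertex_algebra_module V v0 Y U (\<lambda>a n u. \<Phi> (YW a n (inv_into (carrier W) \<Phi> u)))"
proof -
  interpret M: vertex_algebra_module V v0 Y W YW by (rule mod)
  interpret A: vertex_algebra V v0 Y using M.algebra .
  interpret W: module complex_ring W by (rule M.space)
  interpret U: module complex_ring U by (rule U)
  interpret V: module complex_ring V by (rule A.space)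
  let ?\<Psi> = "inv_into (carrier W) \<Phi>"
  let ?Y = "\<lambda>a n u. \<Phi> (YW a n (?\<Psi> u))"
  note D = linear_isoD[OF iso]
  note I = linear_isoD[OF linear_iso_inv[OF iso M.space]]
  note F = state_field_mapD[OF M.fields]
  note zero = linear_iso_zero[OF iso W.abelian_group_axioms U.abelian_group_axioms]
  show ?thesis
  proof (rule vertex_algebra_module.intro[OF M.algebra U])
    show "state_field_map V U ?Y"
      unfolding state_field_map_def
    proof (intro conjI ballI allI)
      fix a w assume "a \<in> carrier V" "w \<in> carrier U"
      then obtain N where "\<And>n. n \<ge> N \<Longrightarrow> YW a n (?\<Psi> w) = \<zero>\<^bsub>W\<^esub>"
        using F(6)[of a "?\<Psi> w"] D(6) by blast
      then show "\<exists>N. \<forall>n\<ge>N. ?Y a n w = \<zero>\<^bsub>U\<^esub>" using zero by (intro exI[of _ N]) simp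
    qed (simp_all add: D(2-4,6) I(3,4) F(1-5))
    show "?Y v0 n w = (if n = - 1 then w else \<zero>\<^bsub>U\<^esub>)" if "w \<in> carrier U" for n w
      using that by (simp add: M.vacuum D(6,7) zero)
    show "borcherds_identity V Y U ?Y"
      unfolding borcherds_identity_def
    proof (intro ballI allI)
      fix a b u and l m n :: int
      assume ab: "a \<in> carrier V" "b \<in> carrier V" and u: "u \<in> carrier U"
      define w where "w = ?\<Psi> u"
      have w: "w \<in> carrier W" "\<Phi> w = u" using u by (simp_all add: w_def D(6,7))
      have tw: "\<Phi> (YW c k x) = ?Y c k (\<Phi> x)" if "x \<in> carrier W" for c k x
        using that by (simp add: D(8))
      have Yab: "Y a k b \<in> carrier V" for k
        by (rule state_field_mapD(1)[OF A.fields ab])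
      have "fin_sum W (\<lambda>j::nat. (of_int m gchoose j) \<odot>\<^bsub>W\<^esub> YW (Y a (l + int j) b) (m + n - int j) w)
          = fin_sum W (borcherds_term W YW a b l m n w)"
        by (rule borcherds_identityD[OF M.borcherds ab w(1)])
      note eq = this
      have bt: "borcherds_term W YW a b l m n w j \<in> carrier W"
        "\<Phi> (borcherds_term W YW a b l m n w j) = borcherds_term U ?Y a b l m n (\<Phi> w) j" for j
        by (rule borcherds_term_iso[where YU = ?Y, OF iso M.space U]; use w(1) ab F(1) tw in simp)+
      have "fin_sum U (\<lambda>j::nat. \<Phi> ((of_int m gchoose j) \<odot>\<^bsub>W\<^esub> YW (Y a (l + int j) b) (m + n - int j) w))
          = \<Phi> (fin_sum W (\<lambda>j::nat. (of_int m gchoose j) \<odot>\<^bsub>W\<^esub> YW (Y a (l + int j) b) (m + n - int j) w))"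
        by (rule linear_iso_fin_sum[OF iso W.abelian_group_axioms U.abelian_group_axioms, symmetric])
           (simp add: F(1) Yab w(1))
      also have "\<dots> = fin_sum U (\<lambda>j. borcherds_term U ?Y a b l m n u j)"
        unfolding eq bt(2)[unfolded w(2), symmetric]
        by (rule linear_iso_fin_sum[OF iso W.abelian_group_axioms U.abelian_group_axioms bt(1)])
      finally show "fin_sum U (\<lambda>j::nat. (of_int m gchoose j) \<odot>\<^bsub>U\<^esub> ?Y (Y a (l + int j) b) (m + n - int j) u) =
        fin_sum U (\<lambda>j::nat. ((- 1) ^ j * (of_int l gchoose j)) \<odot>\<^bsub>U\<^esub>
          (?Y a (m + l - int j) (?Y b (n + int j) u)
           \<ominus>\<^bsub>U\<^esub> ((- 1) powi l) \<odot>\<^bsub>U\<^esub> ?Y b (n + l - int j) (?Y a (m + int j) u)))"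
        using w by (simp add: borcherds_term_def D(4) F(1) Yab flip: w_def)
    qed
  qed
qed

text \<open>For \<open>m = 0\<close> the binomial coefficients kill every term with positive
  \<open>j\<close> on the left of the Borcherds identity.\<close>

lemma mode_product_formula:
  assumes mod: "vertex_algebra_module V v0 Y W YW"
    and ab: "a \<in> carrier V" "b \<in> carrier V" and w: "w \<in> carrier W"
  shows "YW (Y a l b) n w = fin_sum W (borcherds_term W YW a b l 0 n w)"
proof -
  interpret M: vertex_algebra_module V v0 Y W YW by (rule mod)
  interpret A: vertex_algebra V v0 Y by (rule M.algebra)
  interpret W: module complex_ring W by (rule M.space)
  have YW: "YW (Y a k b) i w \<in> carrier W" for k i
    by (intro state_field_mapD(1)[OF M.fields] state_field_mapD(1)[OF A.fields] ab w)
  have "(0 :: complex) gchoose j = 0" if "j \<noteq> 0" for j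
    using that by (cases j) simp_all
  then have "fin_sum W (\<lambda>j::nat. (of_int 0 gchoose j) \<odot>\<^bsub>W\<^esub> YW (Y a (l + int j) b) (0 + n - int j) w) =
    (of_int 0 gchoose 0) \<odot>\<^bsub>W\<^esub> YW (Y a (l + int 0) b) (0 + n - int 0) w"
    using W.smult_l_null[OF YW]
    by (intro fin_sum_singleton W.abelian_group_axioms) (auto simp: complex_ring_zero YW)
  also have "\<dots> = YW (Y a l b) n w"
    using W.smult_one[OF YW] by (simp add: complex_ring_one)
  finally show ?thesis
    using borcherds_identityD[OF M.borcherds ab w, of 0 l n] by (simp only:)
qed

section \<open>Uniqueness of the vertex algebra module structure\<close>

lemma left_ideal_LH_ideal: "left_ideal (LH_ideal cL cLI)"
  by (simp add: LH_ideal_def sum_of_proper_def left_ideal_generated)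

text \<open>The ideal does not contain 1, so it belongs to the family of proper left ideals that
  generates \<open>LH_ideal\<close>.\<close>

lemma verma_ideal_subset_LH_ideal:
  assumes "cLI \<noteq> 0"
  shows "verma_ideal cL 0 cLI 0 0 \<subseteq> LH_ideal cL cLI"
proof -
  interpret free_field 0 0 cL cLI by unfold_locales (rule assms)
  have "1 \<notin> verma_ideal cL 0 cLI 0 0"
    using one_notin_verma_ideal by (simp add: Delta_def)
  then have "verma_ideal cL 0 cLI 0 0 \<subseteq> \<Union>{K. left_ideal K \<and> verma_ideal cL 0 cLI 0 0 \<subseteq> K \<and> 1 \<notin> K}"
    by (intro Union_upper) (simp add: verma_ideal_def left_ideal_induced_ideal)
  then show ?thesis
    unfolding LH_ideal_def sum_of_proper_def using left_ideal_generated_superset by blast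
qed

text \<open>The generators give \<open>gen x - scal (\<chi> x)\<close> without a right factor;
  centrality allows it to be commuted past each letter of \<open>t\<close>.\<close>

lemma central_character:
  assumes "x \<in> Q" "\<And>y. br x y = 0"
  shows "(gen x - scal (\<chi> x)) * t \<in> induced_ideal br Q \<chi>"
proof (induction t rule: tensor_induct)
  case one
  show ?case using induced_ideal_character[OF assms(1)] by simp
next
  case (gen y t)
  have "(gen x - scal (\<chi> x)) * (gen y * t)
      = (gen x * gen y - gen y * gen x - br x y) * t + gen y * ((gen x - scal (\<chi> x)) * t)"
    by (simp add: algebra_simps assms(2) scal_mult sc_mult_left sc_mult_right)
  then show ?case
    using induced_ideal_bracket gen left_idealD(2,3)[OF left_ideal_induced_ideal] by metis
next
  case (add p q)
  then show ?case by (simp add: distrib_left left_idealD[OF left_ideal_induced_ideal])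
next
  case (scale c p)
  then show ?case by (simp add: sc_mult_right left_idealD[OF left_ideal_induced_ideal])
qed

lemma LH_module_structure_unique:
  assumes cLI: "cLI \<noteq> 0" and Y: "LH_structure cL cLI Y"
    and YW: "LH_module_structure cL cLI Y W \<rho> YW"
    and YU: "LH_module_structure cL cLI Y U \<sigma> YU"
    and iso: "linear_iso W U \<Phi>" and tw: "\<And>x w. w \<in> carrier W \<Longrightarrow> \<Phi> (\<rho> x w) = \<sigma> x (\<Phi> w)"
    and a: "a \<in> carrier (LH cL cLI)" and w: "w \<in> carrier W"
  shows "\<Phi> (YW a n w) = YU a n (\<Phi> w)"
proof -
  let ?V = "LH cL cLI" and ?J = "LH_ideal cL cLI"
  interpret A: vertex_algebra ?V "LH_vac cL cLI" Y using Y by (simp add: LH_structure_def)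
  interpret MW: vertex_algebra_module ?V "LH_vac cL cLI" Y W YW using YW by (simp add: LH_module_structure_def)
  interpret MU: vertex_algebra_module ?V "LH_vac cL cLI" Y U YU using YU by (simp add: LH_module_structure_def)
  note ab = module_abelian_group[OF MW.space] module_abelian_group[OF MU.space]
  note D = linear_isoD[OF iso]
  note J = left_ideal_LH_ideal[of cL cLI]
  note FW = state_field_mapD[OF MW.fields] and FU = state_field_mapD[OF MU.fields]
  have fieldsY: "hv_fields cL cLI ?V (LH_rep cL cLI) Y"
    and fieldsW: "hv_fields cL cLI W \<rho> YW" and fieldsU: "hv_fields cL cLI U \<sigma> YU"
    using Y YW YU by (simp_all add: LH_structure_def LH_module_structure_def)
  \<comment> \<open>The states whose fields are intertwined. Closure under all products
    \<open>Y a l b\<close>, together with the vacuum and the two generating states, makes this the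
    whole vertex algebra.\<close>
  define G where "G = {a \<in> carrier ?V. \<forall>n. \<forall>w\<in>carrier W. \<Phi> (YW a n w) = YU a n (\<Phi> w)}"
  have prod: "Y a l b \<in> G" if "a \<in> G" "b \<in> G" for a b l
  proof -
    have mem: "a \<in> carrier ?V" "b \<in> carrier ?V" using that by (simp_all add: G_def)
    have "\<Phi> (YW (Y a l b) n w) = YU (Y a l b) n (\<Phi> w)" if w: "w \<in> carrier W" for n w
    proof -
      have bt: "borcherds_term W YW a b l 0 n w j \<in> carrier W"
        "\<Phi> (borcherds_term W YW a b l 0 n w j) = borcherds_term U YU a b l 0 n (\<Phi> w) j" for j
        by (rule borcherds_term_iso[OF iso MW.space MU.space]; use \<open>a \<in> G\<close> \<open>b \<in> G\<close> w in \<open>auto simp: G_def intro: FW(1)\<close>)+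
      have "\<Phi> (YW (Y a l b) n w) = fin_sum U (\<lambda>j. \<Phi> (borcherds_term W YW a b l 0 n w j))"
        unfolding mode_product_formula[OF MW.vertex_algebra_module_axioms mem w]
        by (rule linear_iso_fin_sum[OF iso ab bt(1)])
      also have "\<dots> = YU (Y a l b) n (\<Phi> w)"
        unfolding bt(2) mode_product_formula[OF MU.vertex_algebra_module_axioms mem D(2)[OF w]] ..
      finally show ?thesis .
    qed
    then show ?thesis using state_field_mapD(1)[OF A.fields mem] by (simp add: G_def)
  qed
  have carrier: "x +o ?J \<in> carrier ?V" for x by (simp add: LH_def quotient_space_simps)
  have rep: "LH_rep cL cLI x (t +o ?J) = (gen x * t) +o ?J" for x t
    by (simp add: LH_rep_def coset_act_coset[OF J])
  have vac: "LH_vac cL cLI \<in> G"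
    using A.vac_closed by (simp add: G_def MW.vacuum MU.vacuum D(2) linear_iso_zero[OF iso ab])
  have gI: "LH_rep cL cLI (hvI (- 1)) (LH_vac cL cLI) \<in> G"
    using fieldsW fieldsU carrier by (simp add: G_def hv_fields_def tw D(2) LH_vac_def rep)
  have gL: "LH_rep cL cLI (hvL (- 2)) (LH_vac cL cLI) \<in> G"
  proof -
    \<comment> \<open>\<open>hv_fields\<close> numbers the modes of the conformal state by
      \<open>n + 1\<close>; an arbitrary index \<open>k\<close> is written as
      \<open>k - 1 + 1\<close>.\<close>
    have "\<Phi> (YW (LH_rep cL cLI (hvL (- 2)) (LH_vac cL cLI)) (k - 1 + 1) w)
      = YU (LH_rep cL cLI (hvL (- 2)) (LH_vac cL cLI)) (k - 1 + 1) (\<Phi> w)" if "w \<in> carrier W" for k w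
      using that fieldsW fieldsU D(2)[OF that] tw[OF that] unfolding hv_fields_def by metis
    then show ?thesis using carrier by (simp add: G_def LH_vac_def rep)
  qed
  \<comment> \<open>The central letters are modes of neither generating state; on the quotient they
    are scalars, so linearity handles them.\<close>
  have central: "(gen x * t) +o ?J = (sc c t) +o ?J"
    if "hv_nonneg x" "\<And>y. hv_bracket x y = 0" "hv_weight cL 0 cLI 0 0 x = c" for x t c
  proof -
    have "(gen x - scal c) * t \<in> verma_ideal cL 0 cLI 0 0"
      using central_character[of x "{x. hv_nonneg x}" hv_bracket "hv_weight cL 0 cLI 0 0" t] that
      by (simp add: verma_ideal_def)
    then show ?thesis
      using verma_ideal_subset_LH_ideal[OF cLI, of cL]
      by (auto simp: coset_eq_iff[OF J] left_diff_distrib scal_mult)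
  qed
  have scale: "sc c t +o ?J \<in> G" if "t +o ?J \<in> G" for c t
  proof -
    have "sc c t +o ?J = c \<odot>\<^bsub>?V\<^esub> (t +o ?J)"
      by (simp add: LH_def quotient_space_simps coset_act_coset[OF J] scal_mult)
    then show ?thesis
      using that carrier[of "sc c t"] by (auto simp: G_def FW(1,3) FU(3) D(2,4))
  qed
  have "t +o ?J \<in> G" for t
  proof (induction t rule: tensor_induct)
    case one
    show ?case using vac by (simp add: LH_vac_def)
  next
    case (gen x t)
    have cent: "(gen x * t) +o ?J \<in> G" if "hv_nonneg x" "\<And>y. hv_bracket x y = 0"
      by (subst central[OF that refl]) (rule scale[OF gen])
    show ?case
    proof (cases x)
      case (hvL n)
      then have "(gen x * t) +o ?J = Y (LH_rep cL cLI (hvL (- 2)) (LH_vac cL cLI)) (n + 1) (t +o ?J)"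
        using fieldsY carrier by (simp add: hv_fields_def rep[symmetric])
      then show ?thesis using prod[OF gL gen] by simp
    next
      case (hvI n)
      then have "(gen x * t) +o ?J = Y (LH_rep cL cLI (hvI (- 1)) (LH_vac cL cLI)) n (t +o ?J)"
        using fieldsY carrier by (simp add: hv_fields_def rep[symmetric])
      then show ?thesis using prod[OF gI gen] by simp
    qed (rule cent; simp)+
  next
    case (add p q)
    have "(p + q) +o ?J = (p +o ?J) \<oplus>\<^bsub>?V\<^esub> (q +o ?J)"
      by (simp add: LH_def quotient_space_simps coset_add[OF J])
    then show ?case
      using add carrier[of "p + q"] by (auto simp: G_def FW(1,2) FU(2) D(2,3))
  qed (rule scale)
  then have "a \<in> G" using a by (auto simp: LH_def quotient_space_simps)
  then show ?thesis using w by (simp add: G_def)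
qed

section \<open>The isomorphism\<close>

context free_field
begin

lemma module_fock: "module complex_ring (fock r s)"
  by (simp add: fock_def fock_ideal_def module_quotient_space left_ideal_induced_ideal)

lemma module_verma: "module complex_ring (verma cL 0 cLI h0 (r - s))"
  by (simp add: verma_def verma_ideal_def module_quotient_space left_ideal_induced_ideal)

lemma heis_field_closed: "w \<in> carrier (fock r s) \<Longrightarrow> heis_field r s d n w \<in> carrier (fock r s)"
  by (auto simp: heis_field_def fock_def quotient_space_simps fock_ideal_def coset_act_coset left_ideal_induced_ideal)

text \<open>At field index \<open>n + 1\<close> the inner index \<open>n + 1 - j - 1\<close> is
  \<open>n - j\<close>, in agreement with \<open>nord\<close>.\<close>

lemma fock_map_normal_product:
  assumes w: "w \<in> carrier (fock r s)"
  shows "normal_product (fock r s) (heis_field r s d) (heis_field r s d) (n + 1) w \<in> carrier (fock r s)"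
    "fock_map (normal_product (fock r s) (heis_field r s d) (heis_field r s d) (n + 1) w) = sug d n (fock_map w)"
proof -
  interpret F: module complex_ring "fock r s" by (rule module_fock)
  let ?f = "\<lambda>j::int. if j < 0 then heis_field r s d j (heis_field r s d (n + 1 - j - 1) w)
    else heis_field r s d (n + 1 - j - 1) (heis_field r s d j w)"
  have f: "?f j \<in> carrier (fock r s)" for j by (simp add: heis_field_closed w)
  show "normal_product (fock r s) (heis_field r s d) (heis_field r s d) (n + 1) w \<in> carrier (fock r s)"
    unfolding normal_product_def fin_sum_def by (rule F.finsum_closed) (use f in auto)
  have "fock_map (?f j) = nord d n j (fock_map w)" for j
    by (simp add: nord_def fock_map_heis_field heis_field_closed w)
  then show "fock_map (normal_product (fock r s) (heis_field r s d) (heis_field r s d) (n + 1) w) = sug d n (fock_map w)"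
    unfolding normal_product_def sug_def
    by (subst linear_iso_fin_sum[OF fock_iso F.abelian_group_axioms abelian_group_pmod f]) (simp add: fin_sum_pmod)
qed

lemma fock_map_rep:
  assumes w: "w \<in> carrier (fock r s)"
  shows "fock_map (fock_rep cL cLI r s x w) = hv_op x (fock_map w)"
proof -
  interpret F: module complex_ring "fock r s" by (rule module_fock)
  note D = linear_isoD[OF fock_iso, unfolded pmod_simps]
  show ?thesis
  proof (cases x)
    case (hvL n)
    then show ?thesis
      using fock_map_normal_product[OF w]
      by (simp add: omega_field_def Let_def deriv_field_def lop_def D(3,4) heis_field_closed w fock_map_heis_field)
  next
    case (hvI n)
    then show ?thesis
      by (simp add: I_field_def D(3) heis_field_closed w fock_map_heis_field zop_hop)
  qed (simp_all add: D(4) w)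
qed

end

theorem proposition2p5:
  fixes cL cLI r s h hI :: complex
  assumes "cLI \<noteq> 0"
    and "h = Delta cL cLI r s"
    and "hI = r - s"
    and "hI / cLI - 1 \<notin> {- of_nat p | p :: nat. p > 0}"
  shows "\<exists>\<Phi>.
    hv_module_iso (fock r s) (fock_rep cL cLI r s)
      (verma cL 0 cLI h hI) (verma_rep cL 0 cLI h hI) \<Phi> \<and>
    (\<forall>Y YF. LH_structure cL cLI Y \<longrightarrow>
      LH_module_structure cL cLI Y (fock r s) (fock_rep cL cLI r s) YF \<longrightarrow>
      (\<exists>YV. LH_module_structure cL cLI Y
         (verma cL 0 cLI h hI) (verma_rep cL 0 cLI h hI) YV) \<and>
      (\<forall>YV. LH_module_structure cL cLI Y
         (verma cL 0 cLI h hI) (verma_rep cL 0 cLI h hI) YV \<longrightarrow>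
         va_module_iso (LH cL cLI) (fock r s) YF (verma cL 0 cLI h hI) YV \<Phi>))"
proof -
  interpret free_field r s cL cLI by unfold_locales (rule assms(1))
  let ?V = "verma cL 0 cLI h hI" and ?\<sigma> = "verma_rep cL 0 cLI h hI"
  \<comment> \<open>A zero of \<open>top_coeff i\<close> means \<open>hI = - i * cLI\<close>, so
    \<open>hI / cLI - 1 = -(i + 1)\<close>: these are exactly the excluded values.\<close>
  have "top_coeff i \<noteq> 0" for i
  proof
    assume "top_coeff i = 0"
    then have "hI = - of_nat i * cLI" using assms(3) by (simp add: top_coeff_def add_eq_0_iff2)
    then have "hI / cLI - 1 = - of_nat (Suc i)" using assms(1) by (simp add: field_simps)
    then show False using assms(4) by blast
  qed
  then have V: "linear_iso ?V pmod verma_map"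
    using verma_iso assms(2,3) by simp
  define \<Phi> where "\<Phi> = (\<lambda>w. inv_into (carrier ?V) verma_map (fock_map w))"
  have mV: "module complex_ring ?V" using module_verma assms(2,3) by simp
  have iso: "linear_iso (fock r s) ?V \<Phi>"
    unfolding \<Phi>_def by (rule linear_iso_comp[OF fock_iso linear_iso_inv[OF V mV]])
  have tw: "\<Phi> (fock_rep cL cLI r s x w) = ?\<sigma> x (\<Phi> w)" if w: "w \<in> carrier (fock r s)" for x w
  proof -
    have \<Phi>w: "\<Phi> w \<in> carrier ?V" by (rule linear_isoD(2)[OF iso w])
    have "verma_map (\<Phi> w) = fock_map w"
      unfolding \<Phi>_def by (rule linear_isoD(7)[OF V]) simp
    then have "\<Phi> (fock_rep cL cLI r s x w) = inv_into (carrier ?V) verma_map (verma_map (?\<sigma> x (\<Phi> w)))"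
      using \<Phi>w assms(2,3) by (simp add: verma_map_rep) (simp add: \<Phi>_def fock_map_rep[OF w])
    moreover have "?\<sigma> x (\<Phi> w) \<in> carrier ?V"
      using \<Phi>w by (auto simp: verma_rep_def verma_def verma_ideal_def quotient_space_simps coset_act_coset left_ideal_induced_ideal)
    ultimately show ?thesis using linear_isoD(8)[OF V] by simp
  qed
  show ?thesis
  proof (rule exI[of _ \<Phi>], intro conjI allI impI)
    show "hv_module_iso (fock r s) (fock_rep cL cLI r s) ?V ?\<sigma> \<Phi>"
      unfolding hv_module_iso_def by (intro conjI iso allI ballI tw)
    fix Y YF
    assume Y: "LH_structure cL cLI Y"
      and YF: "LH_module_structure cL cLI Y (fock r s) (fock_rep cL cLI r s) YF"
    \<comment> \<open>The given structure is conjugated by \<open>\<Phi>\<close>; it has the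
      required generating fields because \<open>\<Phi>\<close> intertwines the Lie algebra
      actions.\<close>
    let ?YV = "\<lambda>a n v. \<Phi> (YF a n (inv_into (carrier (fock r s)) \<Phi> v))"
    have "vertex_algebra_module (LH cL cLI) (LH_vac cL cLI) Y ?V ?YV"
      using YF unfolding LH_module_structure_def by (intro vertex_algebra_module_transport mV iso) (rule conjunct1)
    moreover have "hv_fields cL cLI ?V ?\<sigma> ?YV"
      unfolding hv_fields_def
    proof (intro allI ballI)
      fix n v assume "v \<in> carrier ?V"
      then have w: "inv_into (carrier (fock r s)) \<Phi> v \<in> carrier (fock r s)"
        "\<Phi> (inv_into (carrier (fock r s)) \<Phi> v) = v"
        by (rule linear_isoD(6)[OF iso], rule linear_isoD(7)[OF iso])
      have "hv_fields cL cLI (fock r s) (fock_rep cL cLI r s) YF"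
        using YF by (simp only: LH_module_structure_def)
      then show "?YV (LH_rep cL cLI (hvI (- 1)) (LH_vac cL cLI)) n v = ?\<sigma> (hvI n) v \<and>
          ?YV (LH_rep cL cLI (hvL (- 2)) (LH_vac cL cLI)) (n + 1) v = ?\<sigma> (hvL n) v"
        using tw[OF w(1), of "hvI n"] tw[OF w(1), of "hvL n"] w
        unfolding hv_fields_def by (simp only: simp_thms)
    qed
    ultimately show "\<exists>YV. LH_module_structure cL cLI Y ?V ?\<sigma> YV"
      unfolding LH_module_structure_def by (intro exI[of _ ?YV] conjI)
    show "va_module_iso (LH cL cLI) (fock r s) YF ?V YV \<Phi>"
      if "LH_module_structure cL cLI Y ?V ?\<sigma> YV" for YV
      unfolding va_module_iso_def
    proof (intro conjI iso ballI allI)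
      fix a n w assume "a \<in> carrier (LH cL cLI)" "w \<in> carrier (fock r s)"
      with tw show "\<Phi> (YF a n w) = YV a n (\<Phi> w)"
        by (rule LH_module_structure_unique[OF assms(1) Y YF that iso])
    qed
  qed
qed

end
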